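(* (i) Let $n\ge2$, $1<p_1,p_2<\infty$, $1/p=1/p_1+1/p_2$, and let $q\in(1,\infty)$ be such that $$p<\frac{nq}{1-n+2nq}.$$ Then there exists an odd function $\Omega\in L^q(\mathbb S^{2n-1})$ supported in the set $$\{(\theta_1,\theta_2)\in\mathbb S^{2n-1}:\ |\theta_1-\theta_2|>1/2\}\qquad(\theta_1,\theta_2\in\mathbb R^n)$$ such that the operator $T_\Omega$ (with $m=2$) is not bounded as a bilinear operator from $L^{p_1}(\mathbb R^n)\times L^{p_2}(\mathbb R^n)$ to $L^p(\mathbb R^n)$. (ii) Let $m\ge3$, $1<p_1,\dots,p_m<\infty$, $1/p=1/p_1+\cdots+1/p_m$, and let $q\in(1,\infty)$ be such that $$p<\frac{q}{(q-1)m+2}.$$ Then there exists an odd function $\Omega\in L^q(\mathbb S^{m-1})$ supported in the set $$\{(\theta_1,\dots,\theta_m)\in\mathbb S^{m-1}:\ |\theta_i-\theta_j|>m^{-3/2}\text{ for } i\ne j\}$$ such that the operator $T_\Omega$ (with $n=1$) is not bounded as an $m$-linear operator from $L^{p_1}(\mathbb R)\times\cdots\times L^{p_m}(\mathbb R)$ to $L^p(\mathbb R)$.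
   Context: $\mathbb S^{mn-1}$ is the unit sphere of $\mathbb R^{mn}=(\mathbb R^n)^m$ with its surface measure. Odd means $\Omega(-\theta)=-\Omega(\theta)$; "supported in a set" means vanishing almost everywhere outside it. For $\Omega$ odd and integrable on $\mathbb S^{mn-1}$, the $m$-linear singular integral operator $T_\Omega$ in dimension $n$ is $$T_\Omega(f_1,\dots,f_m)(x)=\operatorname{p.v.}\int_{\mathbb R^{mn}}\frac{\Omega(y/|y|)}{|y|^{mn}}f_1(x-y_1)\cdots f_m(x-y_m)\,dy,\qquad x\in\mathbb R^n,$$ where $y=(y_1,\dots,y_m)$ with $y_i\in\mathbb R^n$, the principal value is $\lim_{\epsilon\to0^+}\int_{|y|>\epsilon}$, and the operator is defined on Schwartz functions $f_1,\dots,f_m$ on $\mathbb R^n$. It is bounded from $L^{p_1}(\mathbb R^n)\times\cdots\times L^{p_m}(\mathbb R^n)$ to $L^p(\mathbb R^n)$ if there is a finite constant $C$ with $\|T_\Omega(f_1,\dots,f_m)\|_{L^p(\mathbb R^n)}\le C\prod_{i=1}^m\|f_i\|_{L^{p_i}(\mathbb R^n)}$ for all Schwartz functions $f_1,\dots,f_m$. *)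

theory Defs
  imports "HOL-Analysis.Analysis"
begin

text \<open>
  Surface measure on the unit sphere of \<open>\<real>\<^sup>N\<close>, normalised so that integration in polar coordinates
  reads \<open>dx = r\<^sup>N\<^sup>-\<^sup>1 dr d\<sigma>(\<theta>)\<close>: the measure of \<open>A\<close> is \<open>N\<close> times the volume of the cone
  \<open>{r\<theta>. 0 < r < 1, \<theta> \<in> A}\<close>.
\<close>
definition sphere_measure :: "'a::euclidean_space measure" where
  "sphere_measure =
     scale_measure (of_nat DIM('a))
       (distr (restrict_space lborel (ball 0 1 - {0})) (restrict_space borel (sphere 0 1))
          (\<lambda>x. x /\<^sub>R norm x))"

lemma space_sphere_measure: "space (sphere_measure :: 'a::euclidean_space measure) = sphere 0 1"
  by (simp add: sphere_measure_def space_scale_measure space_restrict_space)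

lemma sets_sphere_measure:
  "sets (sphere_measure :: 'a::euclidean_space measure) = sets (restrict_space borel (sphere 0 1))"
  by (simp add: sphere_measure_def)

lemma emeasure_sphere_measure:
  fixes A :: "'a::euclidean_space set"
  assumes A: "A \<in> sets sphere_measure"
  shows "emeasure sphere_measure A =
    of_nat DIM('a) * emeasure lborel {r *\<^sub>R \<theta> | r \<theta>. 0 < r \<and> r < 1 \<and> \<theta> \<in> A}"
proof -
  have A': "A \<in> sets (restrict_space borel (sphere 0 1))"
    using A by (simp add: sets_sphere_measure)
  have A1: "norm \<theta> = 1" if "\<theta> \<in> A" for \<theta>
    using sets.sets_into_space[OF A] that by (auto simp: space_sphere_measure)
  let ?M = "restrict_space (lborel :: 'a measure) (ball 0 1 - {0})"
  have m: "(\<lambda>x. x /\<^sub>R norm x) \<in> measurable ?M (restrict_space borel (sphere 0 1))"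
    by (rule measurable_restrict_space2) (auto simp: space_restrict_space intro: measurable_restrict_space1)
  have eq: "(\<lambda>x. x /\<^sub>R norm x) -` A \<inter> space ?M = {r *\<^sub>R \<theta> | r \<theta>. 0 < r \<and> r < 1 \<and> \<theta> \<in> A}"
  proof (intro equalityI subsetI)
    fix x assume "x \<in> (\<lambda>x. x /\<^sub>R norm x) -` A \<inter> space ?M"
    then have "x = norm x *\<^sub>R (x /\<^sub>R norm x) \<and> 0 < norm x \<and> norm x < 1 \<and> x /\<^sub>R norm x \<in> A"
      by (auto simp: space_restrict_space)
    then show "x \<in> {r *\<^sub>R \<theta> | r \<theta>. 0 < r \<and> r < 1 \<and> \<theta> \<in> A}" by blast
  qed (use A1 in \<open>force simp: space_restrict_space\<close>)
  show ?thesis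
    unfolding sphere_measure_def emeasure_scale_measure emeasure_distr[OF m A'] eq[symmetric]
    by (subst emeasure_restrict_space) (auto simp: space_restrict_space)
qed

text \<open>
  The exponent may be smaller than 1, so the following is in general only a quasi-norm; it takes
  the value \<open>\<infinity>\<close> on functions that are not \<open>p\<close>-integrable.
\<close>
definition Lp_norm :: "real \<Rightarrow> 'a measure \<Rightarrow> ('a \<Rightarrow> complex) \<Rightarrow> ennreal" where
  "Lp_norm p M f =
     (let I = \<integral>\<^sup>+ x. ennreal (norm (f x) powr p) \<partial>M
      in if I = \<infinity> then \<infinity> else ennreal (enn2real I powr (1 / p)))"

definition in_Lp :: "real \<Rightarrow> 'a measure \<Rightarrow> ('a \<Rightarrow> complex) \<Rightarrow> bool" where
  "in_Lp p M f \<longleftrightarrow> f \<in> borel_measurable M \<and> Lp_norm p M f < \<infinity>"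

definition partial_deriv ::
    "'a::euclidean_space \<Rightarrow> ('a \<Rightarrow> complex) \<Rightarrow> 'a \<Rightarrow> complex" where
  "partial_deriv b f = (\<lambda>x. frechet_derivative f (at x) b)"

text \<open>
  A list \<open>bs\<close> of basis vectors stands for the iterated partial derivative along its entries.
  Asking all iterated partial derivatives to be (Frechet) differentiable everywhere is smoothness.
\<close>
definition schwartz :: "('a::euclidean_space \<Rightarrow> complex) \<Rightarrow> bool" where
  "schwartz f \<longleftrightarrow>
     (\<forall>bs. set bs \<subseteq> Basis \<longrightarrow>
        (\<forall>x. foldr partial_deriv bs f differentiable (at x)) \<and>
        (\<forall>k::nat. bounded (range (\<lambda>x. norm x ^ k *\<^sub>R foldr partial_deriv bs f x))))"

text \<open>
  Functions on the sphere are rendered as functions on the whole space; only their values on the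
  unit sphere matter.
\<close>
definition odd_on_sphere :: "('a::real_normed_vector \<Rightarrow> complex) \<Rightarrow> bool" where
  "odd_on_sphere \<Omega> \<longleftrightarrow> (\<forall>\<theta>\<in>sphere 0 1. \<Omega> (- \<theta>) = - \<Omega> \<theta>)"

definition supported_in :: "('a::euclidean_space \<Rightarrow> complex) \<Rightarrow> 'a set \<Rightarrow> bool" where
  "supported_in \<Omega> S \<longleftrightarrow> (AE \<theta> in sphere_measure. \<theta> \<notin> S \<longrightarrow> \<Omega> \<theta> = 0)"

text \<open>
  With \<open>'a\<close> of dimension \<open>n\<close>, the type \<open>'a ^ 'm\<close> is \<open>(\<real>\<^sup>n)\<^sup>m\<close> with its Euclidean norm and
  Lebesgue measure.
  For \<open>\<Omega>\<close> odd and integrable on the sphere and Schwartz functions \<open>f i\<close> the truncated integrals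
  converge absolutely and their limit exists, so \<^const>\<open>Lim\<close> is the principal value.
\<close>
definition singular_integral ::
    "('a::euclidean_space ^ 'm::finite \<Rightarrow> complex) \<Rightarrow> ('m \<Rightarrow> 'a \<Rightarrow> complex) \<Rightarrow> 'a \<Rightarrow> complex" where
  "singular_integral \<Omega> f x =
     Lim (at_right 0) (\<lambda>\<epsilon>.
       LINT y : {y. \<epsilon> < norm y} | lborel.
         \<Omega> (y /\<^sub>R norm y) / of_real (norm y ^ (CARD('m) * DIM('a))) *
         (\<Prod>i\<in>UNIV. f i (x - y $ i)))"

definition multilinear_bounded ::
    "(('m::finite \<Rightarrow> 'a::euclidean_space \<Rightarrow> complex) \<Rightarrow> 'a \<Rightarrow> complex) \<Rightarrow> ('m \<Rightarrow> real) \<Rightarrow> real \<Rightarrow> bool"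
  where
  "multilinear_bounded T P p \<longleftrightarrow>
     (\<exists>C::real. \<forall>f. (\<forall>i. schwartz (f i)) \<longrightarrow>
        Lp_norm p lborel (T f) \<le> ennreal C * (\<Prod>i\<in>UNIV. Lp_norm (P i) lborel (f i)))"

end

theory Submission
  imports Defs
begin

text \<open>
  Both parts are the case \<open>m = 2\<close>, respectively \<open>n = 1\<close>, of one construction. Let the inputs \<open>f\<^sub>i\<close> be
  nonnegative bumps of width \<open>\<delta>\<close> around points \<open>a\<^sub>i\<close>. In the integral defining
  \<open>T(f\<^sub>1,\<dots>,f\<^sub>m)(x)\<close> only the points \<open>y\<close> with \<open>y\<^sub>i = x - a\<^sub>i + O(\<delta>)\<close> contribute. Without the error term they
  trace, as \<open>x\<close> varies, an affine subspace of the linear space \<open>L = {(x + s \<theta>\<^sub>i)\<^sub>i. x, s}\<close> with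
  \<open>\<theta>\<close> proportional to \<open>-a\<close>. This space has dimension \<open>n + 1\<close> in \<open>\<real>\<^sup>m\<^sup>n\<close>, and
  \<open>m n > n + 1\<close> leaves a positive codimension \<open>d = m n - n - 1\<close>. A kernel \<open>\<Omega>\<close> which near \<open>\<theta>\<close> equals
  \<open>dist(\<cdot>, L)\<close> to the power \<open>-\<beta>\<close> is therefore of size at least about \<open>\<delta>\<close> to the power \<open>-\<beta>\<close> on the
  whole support of the integrand, for every \<open>x\<close> in a ball that does not depend on \<open>\<delta>\<close>.

  So the norm of the output is at least a constant times \<open>\<delta>\<close> to the power \<open>m n - \<beta>\<close>
  (\<open>singular_integral_cube_bumps_ge\<close>), whereas the
  product of the norms of the inputs is at most a constant times \<open>\<delta>\<close> to the power \<open>n / p\<close>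
  (\<open>Lp_norm_cube_bump_le\<close>). As \<open>\<delta>\<close> tends to \<open>0\<close> boundedness fails as soon as \<open>m n - \<beta> < n / p\<close>.
  The kernel lies in \<open>L\<^sup>q\<close> as soon as \<open>\<beta> q < d\<close>, because the part of the unit ball within distance
  \<open>\<epsilon>\<close> of \<open>L\<close> has volume \<open>O(\<epsilon>\<^sup>d)\<close> (\<open>emeasure_near_diag_plane\<close>). An exponent \<open>\<beta>\<close> with both
  properties exists exactly if \<open>m n - d / q < n / p\<close>, which is the hypothesis on \<open>p\<close>.

  Oddness is obtained by subtracting the reflected kernel. The reflected part lives near
  \<open>-\<theta>\<close>, which the integrand does not see, so there is no cancellation, and since the integrand
  vanishes near the origin the principal value is an ordinary integral. The kernel can be
  confined to any symmetric neighbourhood of \<open>\<plusminus>\<theta>\<close>, so the support condition only asks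
  for one suitable direction: \<open>\<theta> = (e, -e) / \<surd>2\<close> in the first part, and the
  normalisation of \<open>(0, 1, \<dots>, m - 1)\<close> in the second.
\<close>

section \<open>A smooth compactly supported function of one variable\<close>

text \<open>
  The functions \<open>P(x) u\<^sup>-\<^sup>k exp(-1/u)\<close> with \<open>u = 1 - x\<^sup>2\<close>, cut off outside \<open>(-1, 1)\<close>, are
  closed under differentiation. This makes all derivatives of \<open>exp(-1/(1 - x\<^sup>2))\<close> explicit.
\<close>
definition bump_term :: "real poly \<Rightarrow> nat \<Rightarrow> real \<Rightarrow> real" where
  "bump_term P k x = (if \<bar>x\<bar> < 1 then poly P x / (1 - x\<^sup>2) ^ k * exp (- 1 / (1 - x\<^sup>2)) else 0)"

text \<open>
  The numerator after one differentiation. Since \<open>u\<close> has derivative \<open>-2x\<close>, the product rule gives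
  \<open>(P' u\<^sup>2 + 2kxPu - 2xP) u\<^sup>-\<^sup>k\<^sup>-\<^sup>2 exp(-1/u)\<close>; the exponent \<open>k\<close> grows by \<open>2\<close>.
\<close>
definition bump_step :: "real poly \<Rightarrow> nat \<Rightarrow> real poly" where
  "bump_step P k = pderiv P * [:1, 0, -1:]\<^sup>2 + smult (2 * real k) ([:0, 1:] * P * [:1, 0, -1:])
     - [:0, 2:] * P"

text \<open>
  A single term of the exponential series already bounds \<open>exp(1/u)\<close> from below.
\<close>
lemma exp_neg_inverse_le:
  fixes u :: real
  assumes "0 < u"
  shows "exp (- 1 / u) \<le> fact n * u ^ n"
proof -
  have "(1 / u) ^ n / fact n \<le> exp (1 / u)"
  proof -
    have s: "(\<lambda>n. (1 / u) ^ n /\<^sub>R fact n) sums exp (1 / u)" by (rule exp_converges)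
    have "(\<Sum>i\<in>{n}. (1 / u) ^ i /\<^sub>R fact i) \<le> (\<Sum>i. (1 / u) ^ i /\<^sub>R fact i)"
      using s assms by (intro sum_le_suminf) (auto simp: sums_iff)
    then show ?thesis using s by (simp add: sums_iff divide_inverse mult.commute)
  qed
  then show ?thesis
    using assms by (simp add: exp_minus field_simps)
qed

text \<open>
  Near \<open>\<plusminus>1\<close> the factor \<open>exp(-1/u)\<close> beats any power of \<open>1/u\<close>, and \<open>u\<close> is at most twice the
  distance to the endpoint. The quadratic bound gives derivative \<open>0\<close> at the endpoints.
\<close>
lemma bump_term_le_square:
  "\<exists>C. \<forall>x y. \<bar>x\<bar> = 1 \<longrightarrow> \<bar>bump_term P k y\<bar> \<le> C * (y - x)\<^sup>2"
proof -
  have "compact ((\<lambda>x. poly P x) ` {-1..1})"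
    by (intro compact_continuous_image continuous_intros) auto
  then obtain B where B: "\<And>x. x \<in> {-1..1} \<Longrightarrow> \<bar>poly P x\<bar> \<le> B"
    using compact_imp_bounded bounded_iff by (metis image_eqI real_norm_def)
  have B0: "B \<ge> 0" using B[of 0] by simp
  have "\<bar>bump_term P k y\<bar> \<le> 4 * B * fact (k + 2) * (y - x)\<^sup>2" if x: "\<bar>x\<bar> = 1" for x y
  proof (cases "\<bar>y\<bar> < 1")
    case True
    define u where "u = 1 - y\<^sup>2"
    have u0: "u > 0" using True by (simp add: u_def abs_square_less_1)
    have "u = (1 - \<bar>y\<bar>) * (1 + \<bar>y\<bar>)" by (simp add: u_def algebra_simps power2_eq_square)
    also have "\<dots> \<le> \<bar>y - x\<bar> * 2" using True x by (intro mult_mono) auto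
    finally have u1: "u\<^sup>2 \<le> (\<bar>y - x\<bar> * 2)\<^sup>2" using u0 by (intro power_mono) auto
    have "\<bar>bump_term P k y\<bar> = \<bar>poly P y\<bar> / u ^ k * exp (- 1 / u)"
      using True u0 by (simp add: bump_term_def u_def[symmetric] abs_mult)
    also have "\<dots> \<le> B / u ^ k * (fact (k + 2) * u ^ (k + 2))"
      using u0 B[of y] True exp_neg_inverse_le[OF u0, of "k + 2"] B0
      by (intro mult_mono divide_right_mono) (auto simp: abs_less_iff)
    also have "\<dots> = B * fact (k + 2) * u\<^sup>2" using u0 by (simp add: power_add power2_eq_square)
    also have "\<dots> \<le> B * fact (k + 2) * (\<bar>y - x\<bar> * 2)\<^sup>2"
      using u1 B0 by (intro mult_left_mono) auto
    also have "\<dots> = 4 * B * fact (k + 2) * (y - x)\<^sup>2"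
      by (simp only: power_mult_distrib power2_abs) simp
    finally show ?thesis .
  qed (use B0 in \<open>simp add: bump_term_def\<close>)
  then show ?thesis by blast
qed

lemma DERIV_zero_of_quadratic_bound:
  fixes f :: "real \<Rightarrow> real"
  assumes "\<And>y. \<bar>f y - f x\<bar> \<le> C * (y - x)\<^sup>2"
  shows "(f has_real_derivative 0) (at x)"
  unfolding has_field_derivative_iff
proof (rule Lim_null_comparison)
  show "\<forall>\<^sub>F y in at x. norm ((f y - f x) / (y - x)) \<le> C * \<bar>y - x\<bar>"
    unfolding eventually_at_filter
    using assms by (intro always_eventually) (auto simp: divide_simps power2_eq_square mult.assoc)
  show "((\<lambda>y. C * \<bar>y - x\<bar>) \<longlongrightarrow> 0) (at x)"
    by (auto intro!: tendsto_eq_intros)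
qed

lemma DERIV_bump_term:
  "(bump_term P k has_real_derivative bump_term (bump_step P k) (k + 2) x) (at x)"
proof -
  consider "\<bar>x\<bar> < 1" | "\<bar>x\<bar> = 1" | "\<bar>x\<bar> > 1" by linarith
  then show ?thesis
  proof cases
    case 1
    have u0: "1 - x\<^sup>2 > 0" using 1 by (simp add: abs_square_less_1)
    \<comment> \<open>Writing the function in terms of \<open>v = 1/u\<close> turns the computation into polynomial algebra with \<open>u v = 1\<close>.\<close>
    define v where "v y = inverse (1 - y\<^sup>2)" for y :: real
    have uv: "(1 - x\<^sup>2) * v x = 1" using u0 by (simp add: v_def)
    have dv: "(v has_real_derivative 2 * x * (v x)\<^sup>2) (at x)"
      unfolding v_def using u0
      by (auto intro!: derivative_eq_intros simp: power2_eq_square)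
    have "((\<lambda>y. poly P y * v y ^ k * exp (- v y)) has_real_derivative
        poly (pderiv P) x * v x ^ k * exp (- v x)
        + poly P x * (real k * v x ^ (k - 1) * (2 * x * (v x)\<^sup>2)) * exp (- v x)
        - poly P x * v x ^ k * (exp (- v x) * (2 * x * (v x)\<^sup>2))) (at x)"
      by (auto intro!: derivative_eq_intros dv simp: algebra_simps)
    moreover have "poly (pderiv P) x * v x ^ k * exp (- v x)
        + poly P x * (real k * v x ^ (k - 1) * (2 * x * (v x)\<^sup>2)) * exp (- v x)
        - poly P x * v x ^ k * (exp (- v x) * (2 * x * (v x)\<^sup>2))
      = poly (bump_step P k) x * v x ^ (k + 2) * exp (- v x)"
    proof -
      have 1: "real k * v x ^ (k - 1) * (2 * x * (v x)\<^sup>2)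
          = 2 * real k * x * (1 - x\<^sup>2) * v x ^ (k + 2)"
      proof -
        have "real k * v x ^ (k - 1) * (v x)\<^sup>2 = real k * v x ^ k * v x"
          by (cases k) (simp_all add: power2_eq_square)
        also have "\<dots> = real k * v x ^ k * v x * ((1 - x\<^sup>2) * v x)" unfolding uv by simp
        finally have "2 * x * (real k * v x ^ (k - 1) * (v x)\<^sup>2)
            = 2 * x * (real k * v x ^ k * v x * ((1 - x\<^sup>2) * v x))" by simp
        then show ?thesis by (simp only: power_add power2_eq_square ac_simps)
      qed
      have 2: "poly (pderiv P) x * v x ^ k
          = poly (pderiv P) x * (1 - x\<^sup>2)\<^sup>2 * v x ^ (k + 2)"
      proof -
        have "poly (pderiv P) x * v x ^ k = poly (pderiv P) x * v x ^ k * ((1 - x\<^sup>2) * v x)\<^sup>2"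
          unfolding uv by simp
        then show ?thesis by (simp add: power2_eq_square mult_ac)
      qed
      have 3: "poly (bump_step P k) x = poly (pderiv P) x * (1 - x\<^sup>2)\<^sup>2
          + 2 * real k * x * (1 - x\<^sup>2) * poly P x - 2 * x * poly P x"
        by (simp add: bump_step_def algebra_simps power2_eq_square)
      show ?thesis
        unfolding 1 2 3 power_add by (simp add: algebra_simps)
    qed
    ultimately have "((\<lambda>y. poly P y * v y ^ k * exp (- v y)) has_real_derivative
        poly (bump_step P k) x * v x ^ (k + 2) * exp (- v x)) (at x)"
      by (simp only:)
    then have "((\<lambda>x. poly P x / (1 - x\<^sup>2) ^ k * exp (- 1 / (1 - x\<^sup>2)))
        has_real_derivative bump_term (bump_step P k) (k + 2) x) (at x)"
      using 1 by (simp add: bump_term_def v_def divide_inverse power_inverse)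
    then show ?thesis
      by (rule has_field_derivative_transform_within_open[where S = "{-1<..<1}"])
        (use 1 in \<open>auto simp: bump_term_def\<close>)
  next
    case 2
    obtain C where "\<forall>x y. \<bar>x\<bar> = 1 \<longrightarrow> \<bar>bump_term P k y\<bar> \<le> C * (y - x)\<^sup>2"
      using bump_term_le_square by blast
    then have "(bump_term P k has_real_derivative 0) (at x)"
      using 2 by (intro DERIV_zero_of_quadratic_bound[of _ _ C]) (simp add: bump_term_def)
    then show ?thesis using 2 by (simp add: bump_term_def)
  next
    case 3
    have "((\<lambda>x. 0) has_real_derivative bump_term (bump_step P k) (k + 2) x) (at x)"
      using 3 by (auto simp: bump_term_def)
    then show ?thesis
      by (rule has_field_derivative_transform_within_open[where S = "- {-1..1}"])
        (use 3 in \<open>auto simp: bump_term_def\<close>)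
  qed
qed

primrec bump_poly :: "nat \<Rightarrow> real poly" where
  "bump_poly 0 = 1"
| "bump_poly (Suc j) = bump_step (bump_poly j) (2 * j)"

definition bump :: "nat \<Rightarrow> real \<Rightarrow> real" where
  "bump j = bump_term (bump_poly j) (2 * j)"

lemma DERIV_bump: "(bump j has_real_derivative bump (Suc j) x) (at x)"
  using DERIV_bump_term[of "bump_poly j" "2 * j" x] by (simp add: bump_def)

lemma bump_eq_0: "\<bar>x\<bar> \<ge> 1 \<Longrightarrow> bump j x = 0"
  by (simp add: bump_def bump_term_def)

lemma bump_nonneg: "bump 0 x \<ge> 0"
  by (simp add: bump_def bump_term_def)

lemma bump_le_1: "bump 0 x \<le> 1"
  by (auto simp: bump_def bump_term_def abs_square_less_1 less_imp_le)

lemma bump_ge_half: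
  assumes "\<bar>x\<bar> \<le> 1 / 2"
  shows "bump 0 x \<ge> exp (- 2)"
proof -
  have "x\<^sup>2 \<le> (1 / 2)\<^sup>2" using assms by (metis abs_ge_zero power2_abs power_mono)
  then have "1 / (1 - x\<^sup>2) \<le> 2" by (simp add: field_simps power2_eq_square)
  then show ?thesis using assms by (simp add: bump_def bump_term_def)
qed



section \<open>Bumps adapted to cubes\<close>

text \<open>
  A partial derivative of a tensor product only advances one of the one-dimensional factors, so all
  iterated partial derivatives are again tensor products of members of the given chains of derivatives, and these are
  continuous with compact support.
\<close>
lemma schwartz_prod:
  fixes s :: "'a::euclidean_space \<Rightarrow> nat \<Rightarrow> real \<Rightarrow> real"
  assumes deriv: "\<And>b j t. b \<in> Basis \<Longrightarrow> (s b j has_real_derivative s b (Suc j) t) (at t)"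
    and supp: "\<And>b j t. b \<in> Basis \<Longrightarrow> \<bar>t\<bar> > R \<Longrightarrow> s b j t = 0"
  shows "schwartz (\<lambda>x::'a. complex_of_real (\<Prod>b\<in>Basis. s b 0 (x \<bullet> b)))"
proof -
  define F where "F k x = complex_of_real (\<Prod>b\<in>Basis. s b (k b) (x \<bullet> b))" for k and x :: 'a
  have der: "(F k has_derivative (\<lambda>h. complex_of_real (\<Sum>b\<in>Basis. (s b (Suc (k b)) (x \<bullet> b) * (h \<bullet> b)) *
        (\<Prod>c\<in>Basis - {b}. s c (k c) (x \<bullet> c))))) (at x)" for k x
  proof -
    have "((\<lambda>x. s b (k b) (x \<bullet> b)) has_derivative (\<lambda>h. s b (Suc (k b)) (x \<bullet> b) * (h \<bullet> b))) (at x)"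
      if "b \<in> Basis" for b
    proof -
      have "((\<lambda>x. x \<bullet> b) has_derivative (\<lambda>h. h \<bullet> b)) (at x)"
        by (rule bounded_linear_imp_has_derivative[OF bounded_linear_inner_left])
      moreover have "(s b (k b) has_derivative (*) (s b (Suc (k b)) (x \<bullet> b))) (at (x \<bullet> b))"
        using deriv[OF that] by (simp add: has_field_derivative_def)
      ultimately show ?thesis by (rule has_derivative_compose)
    qed
    then have "((\<lambda>x. \<Prod>b\<in>Basis. s b (k b) (x \<bullet> b)) has_derivative
        (\<lambda>h. \<Sum>b\<in>Basis. (s b (Suc (k b)) (x \<bullet> b) * (h \<bullet> b)) *
        (\<Prod>c\<in>Basis - {b}. s c (k c) (x \<bullet> c)))) (at x)"
      by (rule has_derivative_prod)
    then show ?thesis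
      unfolding F_def by (rule bounded_linear.has_derivative[OF bounded_linear_of_real])
  qed
  have pd: "partial_deriv b (F k) = F (k(b := Suc (k b)))" if b: "b \<in> Basis" for b k
  proof
    fix x
    have "partial_deriv b (F k) x = complex_of_real (\<Sum>b'\<in>Basis. (s b' (Suc (k b')) (x \<bullet> b') * (b \<bullet> b')) *
        (\<Prod>c\<in>Basis - {b'}. s c (k c) (x \<bullet> c)))"
      unfolding partial_deriv_def frechet_derivative_at[OF der, symmetric] ..
    also have "(\<Sum>b'\<in>Basis. (s b' (Suc (k b')) (x \<bullet> b') * (b \<bullet> b')) *
        (\<Prod>c\<in>Basis - {b'}. s c (k c) (x \<bullet> c))) =
        (\<Sum>b'\<in>Basis. if b' = b then s b (Suc (k b)) (x \<bullet> b) *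
        (\<Prod>c\<in>Basis - {b}. s c (k c) (x \<bullet> c)) else 0)"
      using b by (intro sum.cong) (auto simp: inner_Basis)
    also have "\<dots> = s b (Suc (k b)) (x \<bullet> b) * (\<Prod>c\<in>Basis - {b}. s c (k c) (x \<bullet> c))"
      using b by simp
    also have "\<dots> = (\<Prod>c\<in>Basis. s c ((k(b := Suc (k b))) c) (x \<bullet> c))"
      using b by (subst prod.remove[of _ b]) (auto intro!: prod.cong)
    finally show "partial_deriv b (F k) x = F (k(b := Suc (k b))) x"
      unfolding F_def by (simp only:)
  qed
  have iter: "\<exists>k. foldr partial_deriv bs (F (\<lambda>_. 0)) = F k" if "set bs \<subseteq> Basis" for bs
    using that
  proof (induction bs)
    case (Cons b bs)
    then obtain k where "foldr partial_deriv bs (F (\<lambda>_. 0)) = F k" by auto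
    then have "foldr partial_deriv (b # bs) (F (\<lambda>_. 0)) = F (k(b := Suc (k b)))"
      using pd[of b k] Cons.prems by simp
    then show ?case by blast
  qed auto
  have bdd: "bounded (range (\<lambda>x. norm x ^ j *\<^sub>R F k x))" for j k
  proof -
    define S where "S = cball (0::'a) (real DIM('a) * R)"
    have cont: "continuous_on UNIV (F k)"
      using der by (meson continuous_at_imp_continuous_on has_derivative_continuous)
    have zero: "F k x = 0" if x: "x \<notin> S" for x
    proof -
      have "\<exists>b\<in>Basis. \<bar>x \<bullet> b\<bar> > R"
      proof (rule ccontr)
        assume "\<not> ?thesis"
        then have "(\<Sum>b\<in>Basis. \<bar>x \<bullet> b\<bar>) \<le> real DIM('a) * R"
          by (intro sum_bounded_above) auto
        then show False using norm_le_l1[of x] x by (simp add: S_def)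
      qed
      then show ?thesis
        unfolding F_def using supp by (auto simp: prod_zero_iff)
    qed
    have "compact ((\<lambda>x. norm x ^ j *\<^sub>R F k x) ` S)"
      using cont by (intro compact_continuous_image continuous_intros) (auto simp: S_def intro: continuous_on_subset)
    then have "bounded (insert 0 ((\<lambda>x. norm x ^ j *\<^sub>R F k x) ` S))"
      by (simp add: compact_imp_bounded)
    then show ?thesis
      by (rule bounded_subset) (use zero in force)
  qed
  have "schwartz (F (\<lambda>_. 0))"
    unfolding schwartz_def
  proof (intro allI impI conjI)
    fix bs :: "'a list" and x j
    assume "set bs \<subseteq> Basis"
    then obtain k where k: "foldr partial_deriv bs (F (\<lambda>_. 0)) = F k" using iter by blast
    show "foldr partial_deriv bs (F (\<lambda>_. 0)) differentiable at x"
      unfolding k using der differentiable_def by blast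
    show "bounded (range (\<lambda>x. norm x ^ j *\<^sub>R foldr partial_deriv bs (F (\<lambda>_. 0)) x))"
      unfolding k by (rule bdd)
  qed
  then show ?thesis unfolding F_def .
qed

lemma mem_cbox_cube_iff:
  fixes y z :: "'a::euclidean_space"
  shows "y \<in> cbox (z - r *\<^sub>R One) (z + r *\<^sub>R One) \<longleftrightarrow> (\<forall>b\<in>Basis. \<bar>(y - z) \<bullet> b\<bar> \<le> r)"
proof -
  have "(z - r *\<^sub>R One) \<bullet> b \<le> y \<bullet> b \<and> y \<bullet> b \<le> (z + r *\<^sub>R One) \<bullet> b \<longleftrightarrow> \<bar>(y - z) \<bullet> b\<bar> \<le> r"
    if "b \<in> Basis" for b
    using that by (simp add: inner_diff_left inner_add_left) linarith
  then show ?thesis by (simp add: mem_box)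
qed

definition cube_bump :: "'a::euclidean_space \<Rightarrow> real \<Rightarrow> 'a \<Rightarrow> real" where
  "cube_bump a \<delta> x = (\<Prod>b\<in>Basis. bump 0 (((x - a) \<bullet> b) / \<delta>))"

lemma schwartz_cube_bump:
  fixes a :: "'a::euclidean_space"
  assumes \<delta>: "\<delta> > 0"
  shows "schwartz (\<lambda>x. complex_of_real (cube_bump a \<delta> x))"
proof -
  define s where "s b j t = bump j ((t - a \<bullet> b) / \<delta>) / \<delta> ^ j" for b :: 'a and j t
  have "schwartz (\<lambda>x::'a. complex_of_real (\<Prod>b\<in>Basis. s b 0 (x \<bullet> b)))"
  proof (rule schwartz_prod[where R = "norm a + \<delta>"])
    fix b :: 'a and j t assume b: "b \<in> Basis"
    have "((\<lambda>t. bump j ((t - a \<bullet> b) / \<delta>)) has_real_derivative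
        bump (Suc j) ((t - a \<bullet> b) / \<delta>) * (1 / \<delta>)) (at t)"
      by (rule DERIV_chain2[OF DERIV_bump]) (use \<delta> in \<open>auto intro!: derivative_eq_intros\<close>)
    from DERIV_cdivide[OF this, of "\<delta> ^ j"]
    show "(s b j has_real_derivative s b (Suc j) t) (at t)"
      unfolding s_def using \<delta> by (simp add: mult.commute)
    assume t: "\<bar>t\<bar> > norm a + \<delta>"
    have "\<bar>a \<bullet> b\<bar> \<le> norm a" using b by (rule Basis_le_norm)
    then have "\<bar>t - a \<bullet> b\<bar> \<ge> \<delta>" using t by linarith
    then show "s b j t = 0" using \<delta> by (simp add: s_def bump_eq_0)
  qed
  then show ?thesis by (simp add: s_def cube_bump_def inner_diff_left)
qed

lemma cube_bump_nonneg: "cube_bump a \<delta> x \<ge> 0"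
  by (simp add: cube_bump_def prod_nonneg bump_nonneg)

lemma cube_bump_le_1: "cube_bump a \<delta> x \<le> 1"
  unfolding cube_bump_def by (intro prod_le_1) (auto simp: bump_nonneg bump_le_1)

lemma cube_bump_neq_0D:
  assumes "cube_bump a \<delta> x \<noteq> 0" "\<delta> > 0" "b \<in> Basis"
  shows "\<bar>(x - a) \<bullet> b\<bar> < \<delta>"
proof -
  have "bump 0 (((x - a) \<bullet> b) / \<delta>) \<noteq> 0"
    using assms by (auto simp: cube_bump_def)
  then have "\<bar>((x - a) \<bullet> b) / \<delta>\<bar> < 1" using bump_eq_0 by (meson not_less)
  then show ?thesis using assms by simp
qed

lemma cube_bump_ge:
  fixes a :: "'a::euclidean_space"
  assumes "\<And>b. b \<in> Basis \<Longrightarrow> \<bar>(x - a) \<bullet> b\<bar> \<le> \<delta> / 2" "\<delta> > 0"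
  shows "cube_bump a \<delta> x \<ge> exp (- 2) ^ DIM('a)"
proof -
  have "(\<Prod>b\<in>(Basis::'a set). exp (- 2)) \<le> cube_bump a \<delta> x"
    unfolding cube_bump_def
    using assms by (intro prod_mono conjI bump_ge_half) (auto simp: field_simps)
  then show ?thesis by simp
qed

lemma continuous_cube_bump: "continuous_on UNIV (cube_bump a \<delta>)"
proof -
  have "continuous_on UNIV (bump 0)"
    using DERIV_bump by (meson DERIV_isCont continuous_at_imp_continuous_on)
  then have "continuous_on UNIV (\<lambda>x. bump 0 (((x - a) \<bullet> b) * inverse \<delta>))" for b
    by (rule continuous_on_compose2) (auto intro!: continuous_intros)
  then show ?thesis
    unfolding cube_bump_def divide_inverse by (intro continuous_on_prod)
qed

lemma Lp_norm_cube_bump_le: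
  fixes a :: "'a::euclidean_space"
  assumes \<delta>: "\<delta> > 0" and P: "P > 0"
  shows "Lp_norm P lborel (\<lambda>x. complex_of_real (cube_bump a \<delta> x))
    \<le> ennreal ((2 * \<delta>) powr (real DIM('a) / P))"
proof -
  define I where "I = (\<integral>\<^sup>+ x. ennreal (norm (complex_of_real (cube_bump a \<delta> x)) powr P) \<partial>lborel)"
  let ?Q = "cbox (a - \<delta> *\<^sub>R One) (a + \<delta> *\<^sub>R One)"
  have "I \<le> (\<integral>\<^sup>+ x. indicator ?Q x \<partial>lborel)"
    unfolding I_def
  proof (rule nn_integral_mono)
    fix x :: 'a
    show "ennreal (norm (complex_of_real (cube_bump a \<delta> x)) powr P) \<le> indicator ?Q x"
    proof (cases "cube_bump a \<delta> x = 0")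
      case False
      have "x \<in> ?Q"
        using cube_bump_neq_0D[OF False \<delta>] unfolding mem_cbox_cube_iff by (auto intro: less_imp_le)
      moreover have "\<bar>cube_bump a \<delta> x\<bar> powr P \<le> 1 powr P"
        using P cube_bump_nonneg[of a \<delta> x] cube_bump_le_1[of a \<delta> x] by (intro powr_mono2) auto
      ultimately show ?thesis by (simp add: ennreal_le_1)
    qed simp
  qed
  also have "\<dots> = emeasure lborel ?Q" by (rule nn_integral_indicator) simp
  also have "\<dots> = ennreal ((2 * \<delta>) ^ DIM('a))"
    using \<delta> by (subst emeasure_lborel_cbox) (auto simp: inner_diff_left inner_add_left)
  finally have I: "I \<le> ennreal ((2 * \<delta>) ^ DIM('a))" .
  then have fin: "I \<noteq> \<infinity>" by (auto simp: top_unique)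
  have "enn2real I \<le> (2 * \<delta>) ^ DIM('a)"
    using I \<delta> by (intro enn2real_leI) auto
  then have "enn2real I powr (1 / P) \<le> ((2 * \<delta>) ^ DIM('a)) powr (1 / P)"
    using P by (intro powr_mono2) auto
  also have "\<dots> = (2 * \<delta>) powr (real DIM('a) / P)"
    using \<delta> powr_realpow[of "2 * \<delta>" "DIM('a)"] powr_powr[of "2 * \<delta>" "real DIM('a)" "1 / P"] by simp
  finally show ?thesis
    using fin unfolding Lp_norm_def I_def[symmetric] Let_def by (simp add: ennreal_leI)
qed

section \<open>Volume near the plane spanned by the diagonal and a direction\<close>

text \<open>
  With \<open>\<theta>\<close> off the diagonal this is a linear subspace of dimension \<open>n + 1\<close>, where \<open>n\<close> is the dimension of
  \<open>'a\<close>.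
\<close>
definition diag_plane :: "'a::euclidean_space ^ 'm::finite \<Rightarrow> ('a ^ 'm) set" where
  "diag_plane \<theta> = {y. \<exists>x s. y = (\<chi> i. x + s *\<^sub>R \<theta> $ i)}"

lemma diag_plane_scaleR: "l \<in> diag_plane \<theta> \<Longrightarrow> c *\<^sub>R l \<in> diag_plane \<theta>"
proof -
  assume "l \<in> diag_plane \<theta>"
  then obtain x s where l: "l = (\<chi> i. x + s *\<^sub>R \<theta> $ i)" by (auto simp: diag_plane_def)
  have "c *\<^sub>R l = (\<chi> i. c *\<^sub>R x + (c * s) *\<^sub>R \<theta> $ i)"
    by (simp add: l vec_eq_iff scaleR_add_right)
  then show ?thesis unfolding diag_plane_def by blast
qed

lemma zero_in_diag_plane: "0 \<in> diag_plane \<theta>"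
  by (auto simp: diag_plane_def vec_eq_iff intro!: exI[of _ 0])

lemma infdist_scaleR_cone:
  fixes L :: "'a::real_normed_vector set"
  assumes L: "\<And>c l. l \<in> L \<Longrightarrow> c *\<^sub>R l \<in> L" and c: "c \<noteq> 0"
  shows "infdist (c *\<^sub>R y) L = \<bar>c\<bar> * infdist y L"
proof (cases "L = {}")
  case False
  have le: "infdist (c *\<^sub>R y) L \<le> \<bar>c\<bar> * infdist y L" if c: "c \<noteq> 0" for c y
  proof -
    have "infdist (c *\<^sub>R y) L / \<bar>c\<bar> \<le> dist y l" if "l \<in> L" for l
    proof -
      have "infdist (c *\<^sub>R y) L \<le> dist (c *\<^sub>R y) (c *\<^sub>R l)" using L that by (intro infdist_le)
      also have "\<dots> = \<bar>c\<bar> * dist y l" by (simp add: dist_norm scaleR_diff_right[symmetric])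
      finally show ?thesis using c by (simp add: field_simps)
    qed
    then have "infdist (c *\<^sub>R y) L / \<bar>c\<bar> \<le> infdist y L"
      unfolding infdist_notempty[OF False] using False by (intro cINF_greatest)
    then show ?thesis using c by (simp add: field_simps)
  qed
  have "\<bar>c\<bar> * infdist y L = \<bar>c\<bar> * infdist (inverse c *\<^sub>R c *\<^sub>R y) L" using c by simp
  also have "\<dots> \<le> \<bar>c\<bar> * (\<bar>inverse c\<bar> * infdist (c *\<^sub>R y) L)"
    using c by (intro mult_left_mono le) auto
  also have "\<dots> = infdist (c *\<^sub>R y) L" using c by simp
  finally show ?thesis using le[OF c] by (simp add: antisym)
qed (simp add: infdist_def)

lemma borel_measurable_infdist [measurable]: "(\<lambda>y. infdist y A) \<in> borel_measurable borel"
  by (intro borel_measurable_continuous_onI continuous_intros)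

lemma sets_infdist_le: "{y \<in> ball x r. infdist y A \<le> c} \<in> sets borel"
proof -
  have "{y. infdist y A \<le> c} \<in> sets borel" by measurable
  then have "ball x r \<inter> {y. infdist y A \<le> c} \<in> sets borel" by (intro sets.Int) auto
  then show ?thesis by (simp add: Int_def)
qed

lemma inner_Basis_vec_iff:
  fixes P :: "real \<Rightarrow> bool"
  shows "(\<forall>b\<in>Basis. P ((z :: 'a::euclidean_space ^ 'm::finite) \<bullet> b)) \<longleftrightarrow> (\<forall>i. \<forall>e\<in>Basis. P (z $ i \<bullet> e))"
  by (auto simp: Basis_vec_def inner_axis)

text \<open>
  The difference of the components \<open>i\<close> and \<open>j\<close> eliminates \<open>x\<close> and controls \<open>s\<close>; then any component
  controls \<open>x\<close>.
\<close>
lemma diag_plane_coordinates_bounded: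
  fixes \<theta> :: "'a::euclidean_space ^ 'm::finite"
  assumes ij: "\<theta> $ i \<noteq> \<theta> $ j"
  obtains M where "M \<ge> 1"
    "\<And>x s. norm (\<chi> i. x + s *\<^sub>R \<theta> $ i) \<le> 3 \<Longrightarrow> norm x \<le> M \<and> \<bar>s\<bar> \<le> M"
proof -
  define c where "c = norm (\<theta> $ i - \<theta> $ j)"
  have c: "c > 0" using ij by (simp add: c_def)
  define M where "M = 3 + 6 / c * norm (\<theta> $ i) + 6 / c"
  have "norm x \<le> M \<and> \<bar>s\<bar> \<le> M" if *: "norm (\<chi> i. x + s *\<^sub>R \<theta> $ i) \<le> 3" for x s
  proof -
    define l where "l = (\<chi> i. x + s *\<^sub>R \<theta> $ i)"
    have l: "norm (l $ k) \<le> 3" for k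
      using * Finite_Cartesian_Product.norm_nth_le[of l k] by (simp add: l_def)
    have "l $ i - l $ j = s *\<^sub>R (\<theta> $ i - \<theta> $ j)" by (simp add: l_def algebra_simps)
    then have "\<bar>s\<bar> * c \<le> norm (l $ i) + norm (l $ j)"
      unfolding c_def norm_scaleR[symmetric] by (metis norm_triangle_ineq4)
    then have s: "\<bar>s\<bar> \<le> 6 / c" using l[of i] l[of j] c by (simp add: field_simps)
    have "x = l $ i - s *\<^sub>R \<theta> $ i" by (simp add: l_def)
    then have "norm x \<le> norm (l $ i) + \<bar>s\<bar> * norm (\<theta> $ i)"
      by (metis norm_scaleR norm_triangle_ineq4)
    also have "\<dots> \<le> 3 + 6 / c * norm (\<theta> $ i)"
      using l s by (intro add_mono mult_right_mono) auto
    finally show ?thesis using s c by (simp add: M_def add_increasing add_increasing2)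
  qed
  moreover have "M \<ge> 1" using c by (simp add: M_def add_increasing2)
  ultimately show thesis using that by blast
qed

lemma floor_grid:
  fixes t M \<epsilon> :: real
  assumes "\<bar>t\<bar> \<le> M" "\<epsilon> > 0"
  shows "\<lfloor>t / \<epsilon>\<rfloor> \<in> {-\<lceil>M / \<epsilon>\<rceil>..\<lceil>M / \<epsilon>\<rceil>}" "\<bar>t - \<epsilon> * real_of_int \<lfloor>t / \<epsilon>\<rfloor>\<bar> \<le> \<epsilon>"
proof -
  have "\<lfloor>t / \<epsilon>\<rfloor> \<le> \<lfloor>M / \<epsilon>\<rfloor>" "\<lfloor>- M / \<epsilon>\<rfloor> \<le> \<lfloor>t / \<epsilon>\<rfloor>"
    using assms by (intro floor_mono divide_right_mono; linarith)+
  moreover have "\<lfloor>- M / \<epsilon>\<rfloor> = - \<lceil>M / \<epsilon>\<rceil>" by (simp add: ceiling_def)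
  moreover have "\<lfloor>M / \<epsilon>\<rfloor> \<le> \<lceil>M / \<epsilon>\<rceil>" by linarith
  ultimately show "\<lfloor>t / \<epsilon>\<rfloor> \<in> {-\<lceil>M / \<epsilon>\<rceil>..\<lceil>M / \<epsilon>\<rceil>}"
    unfolding atLeastAtMost_iff by linarith
  have "\<epsilon> * real_of_int \<lfloor>t / \<epsilon>\<rfloor> \<le> t" "t < \<epsilon> * real_of_int \<lfloor>t / \<epsilon>\<rfloor> + \<epsilon>"
    using floor_divide_lower[OF assms(2), of t] floor_divide_upper[OF assms(2), of t]
    by (simp_all add: algebra_simps)
  then show "\<bar>t - \<epsilon> * real_of_int \<lfloor>t / \<epsilon>\<rfloor>\<bar> \<le> \<epsilon>" by linarith
qed

text \<open>
  A point at distance at most \<open>\<epsilon>\<close> from the plane is close to \<open>(x + s \<theta>\<^sub>i)\<^sub>i\<close> with bounded \<open>x\<close> and \<open>s\<close>.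
  Rounding the \<open>n + 1\<close> real parameters \<open>x, s\<close> to multiples of \<open>\<epsilon>\<close> covers the set by
  \<open>O(\<epsilon>\<^sup>-\<^sup>n\<^sup>-\<^sup>1)\<close> cubes of side \<open>8\<epsilon>\<close>, each of volume \<open>O(\<epsilon>\<^sup>m\<^sup>n)\<close>.
\<close>
lemma emeasure_near_diag_plane:
  fixes \<theta> :: "'a::euclidean_space ^ 'm::finite"
  assumes \<theta>: "norm \<theta> = 1" and ij: "\<theta> $ i \<noteq> \<theta> $ j"
    and d: "CARD('m) * DIM('a) = DIM('a) + 1 + d"
  shows "\<exists>C\<ge>0. \<forall>\<epsilon>. 0 < \<epsilon> \<longrightarrow> \<epsilon> \<le> 1 \<longrightarrow>
    emeasure lborel {y \<in> ball 0 1. infdist y (diag_plane \<theta>) \<le> \<epsilon>} \<le> ennreal (C * \<epsilon> ^ d)"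
proof -
  obtain M where M1: "M \<ge> 1" and
    M: "\<And>x s. norm (\<chi> i. x + s *\<^sub>R \<theta> $ i) \<le> 3 \<Longrightarrow> norm x \<le> M \<and> \<bar>s\<bar> \<le> M"
    using diag_plane_coordinates_bounded[OF ij] by metis
  \<comment> \<open>Number of cubes at most \<open>((2M + 3)/\<epsilon>)\<^sup>n\<^sup>+\<^sup>1\<close>, each of volume \<open>(8\<epsilon>)\<^sup>m\<^sup>n\<close>.\<close>
  define C where "C = (2 * M + 3) ^ (DIM('a) + 1) * 8 ^ (CARD('m) * DIM('a))"
  have "emeasure lborel {y \<in> ball 0 1. infdist y (diag_plane \<theta>) \<le> \<epsilon>} \<le> ennreal (C * \<epsilon> ^ d)"
    if e: "0 < \<epsilon>" "\<epsilon> \<le> 1" for \<epsilon>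
  proof -
    define K where "K = \<lceil>M / \<epsilon>\<rceil>"
    define G where "G = ((Basis::'a set) \<rightarrow>\<^sub>E {-K..K}) \<times> {-K..K}"
    define g where "g = (\<lambda>(k, j). \<chi> i. (\<Sum>e\<in>Basis. (\<epsilon> * real_of_int (k e)) *\<^sub>R e)
        + (\<epsilon> * real_of_int j) *\<^sub>R \<theta> $ i)"
    \<comment> \<open>Half side \<open>4\<epsilon>\<close>: the point is within \<open>2\<epsilon>\<close> of the plane, and rounding \<open>x\<close> and \<open>s\<close> costs \<open>\<epsilon>\<close> each.\<close>
    define Q where "Q z = cbox (z - (4 * \<epsilon>) *\<^sub>R One) (z + (4 * \<epsilon>) *\<^sub>R One)" for z :: "'a ^ 'm"
    have Q_iff: "y \<in> Q z \<longleftrightarrow> (\<forall>i. \<forall>e\<in>Basis. \<bar>(y - z) $ i \<bullet> e\<bar> \<le> 4 * \<epsilon>)" for y z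
    proof -
      have "y \<in> Q z \<longleftrightarrow> (\<forall>b\<in>Basis. \<bar>(y - z) \<bullet> b\<bar> \<le> 4 * \<epsilon>)"
        unfolding Q_def by (rule mem_cbox_cube_iff)
      then show ?thesis using inner_Basis_vec_iff[of "\<lambda>t. \<bar>t\<bar> \<le> 4 * \<epsilon>" "y - z"] by simp
    qed
    have "finite G" by (auto simp: G_def intro!: finite_PiE)
    have cover: "{y \<in> ball 0 1. infdist y (diag_plane \<theta>) \<le> \<epsilon>} \<subseteq> (\<Union>k\<in>G. Q (g k))"
    proof
      fix y :: "'a ^ 'm" assume "y \<in> {y \<in> ball 0 1. infdist y (diag_plane \<theta>) \<le> \<epsilon>}"
      then have y: "norm y < 1" "infdist y (diag_plane \<theta>) < 2 * \<epsilon>" using e by auto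
      have ne: "diag_plane \<theta> \<noteq> {}" using zero_in_diag_plane by auto
      obtain l where l: "l \<in> diag_plane \<theta>" "dist y l < 2 * \<epsilon>"
        using y(2) unfolding infdist_notempty[OF ne] by (subst (asm) cINF_less_iff) (use ne in auto)
      obtain x s where xs: "l = (\<chi> i. x + s *\<^sub>R \<theta> $ i)" using l(1) by (auto simp: diag_plane_def)
      have "norm l \<le> 3" using l(2) y(1) e norm_triangle_ineq4[of y "y - l"] by (simp add: dist_norm)
      then have b: "norm x \<le> M" "\<bar>s\<bar> \<le> M" using M xs by auto
      then have bx: "\<bar>x \<bullet> e\<bar> \<le> M" if "e \<in> Basis" for e
        using Basis_le_norm[OF that, of x] by linarith
      define k where "k = restrict (\<lambda>e. \<lfloor>(x \<bullet> e) / \<epsilon>\<rfloor>) Basis"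
      define j where "j = \<lfloor>s / \<epsilon>\<rfloor>"
      have kj: "(k, j) \<in> G"
        unfolding G_def k_def j_def K_def
        using floor_grid(1)[OF _ e(1)] b bx by (simp del: atLeastAtMost_iff)
      have "\<bar>(y - g (k, j)) $ i \<bullet> e\<bar> \<le> 4 * \<epsilon>" if eB: "e \<in> Basis" for i e
      proof -
        have 1: "\<bar>(y - l) $ i \<bullet> e\<bar> \<le> 2 * \<epsilon>"
          using Basis_le_norm[OF eB, of "(y - l) $ i"] Finite_Cartesian_Product.norm_nth_le[of "y - l" i] l(2)
          by (simp add: dist_norm)
        have 2: "\<bar>x \<bullet> e - \<epsilon> * real_of_int (k e)\<bar> \<le> \<epsilon>"
          using floor_grid(2)[OF bx[OF eB] e(1)] eB by (simp add: k_def)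
        have "\<bar>\<theta> $ i \<bullet> e\<bar> \<le> 1"
          using Basis_le_norm[OF eB, of "\<theta> $ i"] Finite_Cartesian_Product.norm_nth_le[of \<theta> i] \<theta> by linarith
        then have 3: "\<bar>(s - \<epsilon> * real_of_int j) * (\<theta> $ i \<bullet> e)\<bar> \<le> \<epsilon>"
          using mult_mono[OF floor_grid(2)[OF b(2) e(1)], of "\<bar>\<theta> $ i \<bullet> e\<bar>" 1] e
          by (simp add: j_def abs_mult)
        have "(\<Sum>e'\<in>Basis. (\<epsilon> * real_of_int (k e')) *\<^sub>R e') \<bullet> e = \<epsilon> * real_of_int (k e)"
          using eB by (simp add: inner_sum_left inner_Basis if_distrib sum.If_cases cong: if_cong)
        then have "(y - g (k, j)) $ i \<bullet> e = (y - l) $ i \<bullet> e + (x \<bullet> e - \<epsilon> * real_of_int (k e))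
          + (s - \<epsilon> * real_of_int j) * (\<theta> $ i \<bullet> e)"
          by (simp add: g_def xs inner_diff_left inner_add_left algebra_simps)
        then show ?thesis using 1 2 3 by linarith
      qed
      then have "y \<in> Q (g (k, j))" by (simp add: Q_iff)
      then show "y \<in> (\<Union>k\<in>G. Q (g k))" using kj by blast
    qed
    have Qm: "emeasure lborel (Q z) = ennreal ((8 * \<epsilon>) ^ (CARD('m) * DIM('a)))" for z
      unfolding Q_def using e by (subst emeasure_lborel_cbox) (auto simp: inner_diff_left inner_add_left)
    have "emeasure lborel {y \<in> ball 0 1. infdist y (diag_plane \<theta>) \<le> \<epsilon>}
        \<le> emeasure lborel (\<Union>k\<in>G. Q (g k))"
      by (rule emeasure_mono[OF cover]) (use \<open>finite G\<close> in \<open>auto simp: Q_def\<close>)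
    also have "\<dots> \<le> (\<Sum>k\<in>G. emeasure lborel (Q (g k)))"
      by (rule emeasure_subadditive_finite[OF \<open>finite G\<close>]) (auto simp: Q_def)
    also have "\<dots> = ennreal (real (card G) * (8 * \<epsilon>) ^ (CARD('m) * DIM('a)))"
      using e by (simp add: Qm ennreal_of_nat_eq_real_of_nat ennreal_mult)
    also have "\<dots> \<le> ennreal (C * \<epsilon> ^ d)"
    proof (rule ennreal_leI)
      have "M / \<epsilon> \<ge> 0" using M1 e by simp
      then have K0: "K \<ge> 0" unfolding K_def by linarith
      have cK: "real (card {-K..K}) \<le> (2 * M + 3) / \<epsilon>"
      proof -
        have "real (card {-K..K}) = 2 * real_of_int K + 1" using K0 by simp
        also have "\<dots> \<le> 2 * (M / \<epsilon> + 1) + 1"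
        proof -
          have "real_of_int K \<le> M / \<epsilon> + 1" unfolding K_def by (rule of_int_ceiling_le_add_one)
          then show ?thesis by (intro add_right_mono mult_left_mono) auto
        qed
        also have "\<dots> \<le> (2 * M + 3) / \<epsilon>" using e by (simp add: field_simps)
        finally show ?thesis .
      qed
      have "real (card G) = real (card {-K..K}) ^ (DIM('a) + 1)"
        by (simp add: G_def card_cartesian_product card_funcsetE)
      also have "\<dots> \<le> ((2 * M + 3) / \<epsilon>) ^ (DIM('a) + 1)"
        using cK by (intro power_mono) auto
      finally have "real (card G) * (8 * \<epsilon>) ^ (CARD('m) * DIM('a))
          \<le> ((2 * M + 3) / \<epsilon>) ^ (DIM('a) + 1) * (8 * \<epsilon>) ^ (CARD('m) * DIM('a))"
        using e by (intro mult_right_mono) auto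
      also have "\<dots> = (2 * M + 3) ^ (DIM('a) + 1) * 8 ^ (CARD('m) * DIM('a))
          * (\<epsilon> ^ (CARD('m) * DIM('a)) / \<epsilon> ^ (DIM('a) + 1))"
        by (simp only: power_divide power_mult_distrib) simp
      also have "\<epsilon> ^ (CARD('m) * DIM('a)) / \<epsilon> ^ (DIM('a) + 1) = \<epsilon> ^ d"
        using e unfolding d by (simp add: power_add)
      finally show "real (card G) * (8 * \<epsilon>) ^ (CARD('m) * DIM('a)) \<le> C * \<epsilon> ^ d"
        by (simp only: C_def)
    qed
    finally show ?thesis .
  qed
  moreover have "C \<ge> 0" using M1 by (simp add: C_def)
  ultimately show ?thesis by blast
qed

lemma dyadic_level:
  fixes t :: real
  assumes "0 < t" "t \<le> 1"
  obtains k :: nat where "t \<le> (1 / 2) ^ k" "(1 / 2) ^ Suc k < t"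
proof -
  define n where "n = (LEAST n. (1 / 2) ^ n < t)"
  have "\<exists>n. (1 / 2) ^ n < t" using assms by (intro real_arch_pow_inv) auto
  then have n: "(1 / 2) ^ n < t" unfolding n_def by (rule LeastI_ex)
  then have "n \<noteq> 0" using assms by (cases n) auto
  then obtain k where k: "n = Suc k" by (cases n) auto
  then have "\<not> (1 / 2) ^ k < t" unfolding n_def using not_less_Least[of k] by (metis lessI)
  then show thesis using that[of k] n k by auto
qed

text \<open>
  Splitting into dyadic shells on which the distance is about \<open>2\<^sup>-\<^sup>k\<close>, the volume estimate
  bounds the integral by a geometric series of ratio \<open>2\<^sup>s\<^sup>-\<^sup>d < 1\<close>.
\<close>
lemma nn_integral_infdist_diag_plane_finite:
  fixes \<theta> :: "'a::euclidean_space ^ 'm::finite"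
  assumes \<theta>: "norm \<theta> = 1" and ij: "\<theta> $ i \<noteq> \<theta> $ j"
    and d: "CARD('m) * DIM('a) = DIM('a) + 1 + d" and s: "0 \<le> s" "s < real d"
  shows "(\<integral>\<^sup>+ y. ennreal (infdist y (diag_plane \<theta>) powr (- s)) * indicator (ball 0 1) y \<partial>lborel) < \<infinity>"
proof -
  let ?r = "\<lambda>y. infdist y (diag_plane \<theta>)"
  obtain C where C: "C \<ge> 0" and "\<forall>\<epsilon>. 0 < \<epsilon> \<longrightarrow> \<epsilon> \<le> 1 \<longrightarrow>
    emeasure lborel {y \<in> ball 0 1. ?r y \<le> \<epsilon>} \<le> ennreal (C * \<epsilon> ^ d)"
    using emeasure_near_diag_plane[OF \<theta> ij d] by blast
  then have C2: "emeasure lborel {y \<in> ball 0 1. ?r y \<le> \<epsilon>} \<le> ennreal (C * \<epsilon> ^ d)"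
    if "0 < \<epsilon>" "\<epsilon> \<le> 1" for \<epsilon> using that by blast
  define S where "S k = {y \<in> ball 0 1. ?r y \<le> (1 / 2) ^ k}" for k :: nat
  define w where "w k = 2 powr (s * real (Suc k))" for k :: nat
  have S_sets: "S k \<in> sets lborel" for k
    unfolding S_def using sets_infdist_le by simp
  have "(\<integral>\<^sup>+ y. ennreal (?r y powr (- s)) * indicator (ball 0 1) y \<partial>lborel)
      \<le> (\<integral>\<^sup>+ y. (\<Sum>k. ennreal (w k) * indicator (S k) y) \<partial>lborel)"
  proof (rule nn_integral_mono)
    fix y :: "'a ^ 'm"
    show "ennreal (?r y powr (- s)) * indicator (ball 0 1) y \<le> (\<Sum>k. ennreal (w k) * indicator (S k) y)"
    proof (cases "y \<in> ball 0 1 \<and> ?r y \<noteq> 0")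
      case True
      have "?r y \<le> dist y 0" by (rule infdist_le[OF zero_in_diag_plane])
      then have r: "0 < ?r y" "?r y \<le> 1" using True infdist_nonneg[of y "diag_plane \<theta>"] by auto
      obtain k where k: "?r y \<le> (1 / 2) ^ k" "(1 / 2) ^ Suc k < ?r y"
        by (rule dyadic_level[OF r])
      have "?r y powr (- s) \<le> ((1 / 2) ^ Suc k) powr (- s)"
        using k s by (intro powr_mono2') auto
      also have "(1 / 2 :: real) ^ Suc k = 2 powr (- real (Suc k))"
        by (simp only: powr_minus powr_realpow[of 2, simplified] power_one_over inverse_eq_divide)
      also have "(2 powr (- real (Suc k))) powr (- s) = w k"
        by (simp only: powr_powr w_def) (simp add: algebra_simps)
      finally have "ennreal (?r y powr (- s)) * indicator (ball 0 1) y
          \<le> ennreal (w k) * indicator (S k) y"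
        using True k by (simp add: S_def ennreal_leI)
      also have "\<dots> = (\<Sum>k\<in>{k}. ennreal (w k) * indicator (S k) y)"
        by (subst sum.insert) auto
      also have "\<dots> \<le> (\<Sum>k. ennreal (w k) * indicator (S k) y)"
        by (rule sum_le_suminf) auto
      finally show ?thesis .
    qed auto
  qed
  also have "\<dots> = (\<Sum>k. \<integral>\<^sup>+ y. ennreal (w k) * indicator (S k) y \<partial>lborel)"
    using S_sets by (intro nn_integral_suminf) auto
  also have "\<dots> = (\<Sum>k. ennreal (w k) * emeasure lborel (S k))"
    using S_sets by (subst nn_integral_cmult_indicator) auto
  also have "\<dots> \<le> (\<Sum>k. ennreal (C * 2 powr s * (2 powr (s - real d)) ^ k))"
  proof (rule suminf_le)
    fix k
    have "ennreal (w k) * emeasure lborel (S k) \<le> ennreal (w k) * ennreal (C * ((1 / 2) ^ k) ^ d)"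
      unfolding S_def by (intro mult_left_mono C2) (auto simp: power_le_one)
    also have "\<dots> = ennreal (w k * (C * ((1 / 2) ^ k) ^ d))"
      using C by (simp add: ennreal_mult' w_def)
    also have "w k * (C * ((1 / 2) ^ k) ^ d) = C * 2 powr s * (2 powr (s - real d)) ^ k"
    proof -
      have "(1 / 2 :: real) ^ k = 2 powr (- real k)"
        by (simp only: powr_minus powr_realpow[of 2, simplified] power_one_over inverse_eq_divide)
      then have "((1 / 2 :: real) ^ k) ^ d = 2 powr (- real k * real d)"
        by (simp add: powr_powr powr_realpow[symmetric])
      moreover have "(2 powr (s - real d)) ^ k = 2 powr ((s - real d) * real k)"
        by (simp add: powr_powr powr_realpow[symmetric])
      ultimately show ?thesis
        by (simp add: w_def powr_add[symmetric] algebra_simps)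
    qed
    finally show "ennreal (w k) * emeasure lborel (S k)
        \<le> ennreal (C * 2 powr s * (2 powr (s - real d)) ^ k)" .
  qed auto
  also have "\<dots> = ennreal (\<Sum>k. C * 2 powr s * (2 powr (s - real d)) ^ k)"
  proof (rule suminf_ennreal2)
    have "2 powr (s - real d) < 1" using s by (simp add: powr_less_one)
    then show "summable (\<lambda>k. C * 2 powr s * (2 powr (s - real d)) ^ k)"
      by (intro summable_mult summable_geometric) auto
  qed (use C in auto)
  also have "\<dots> < \<infinity>" by simp
  finally show ?thesis .
qed

text \<open>
  Real powers satisfy \<open>0 powr a = 0\<close>, so lower bounds for a negative power of the distance hold only off
  the plane; the plane is a null set by the volume estimate.
\<close>
lemma AE_infdist_diag_plane_pos:
  fixes \<theta> :: "'a::euclidean_space ^ 'm::finite"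
  assumes \<theta>: "norm \<theta> = 1" and ij: "\<theta> $ i \<noteq> \<theta> $ j"
    and d: "CARD('m) * DIM('a) = DIM('a) + 1 + d" and d0: "d > 0"
  shows "AE y in lborel. y \<in> ball 0 1 \<longrightarrow> infdist y (diag_plane \<theta>) > 0"
proof -
  let ?r = "\<lambda>y. infdist y (diag_plane \<theta>)"
  obtain C where C: "C \<ge> 0" and "\<forall>\<epsilon>. 0 < \<epsilon> \<longrightarrow> \<epsilon> \<le> 1 \<longrightarrow>
    emeasure lborel {y \<in> ball 0 1. ?r y \<le> \<epsilon>} \<le> ennreal (C * \<epsilon> ^ d)"
    using emeasure_near_diag_plane[OF \<theta> ij d] by blast
  then have C2: "emeasure lborel {y \<in> ball 0 1. ?r y \<le> \<epsilon>} \<le> ennreal (C * \<epsilon> ^ d)"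
    if "0 < \<epsilon>" "\<epsilon> \<le> 1" for \<epsilon> using that by blast
  let ?Z = "{y \<in> ball 0 1. ?r y \<le> 0}"
  have Z: "?Z \<in> sets lborel" using sets_infdist_le by simp
  have le: "emeasure lborel ?Z \<le> ennreal (C * (1 / 2) ^ k)" for k :: nat
  proof -
    have "emeasure lborel ?Z \<le> emeasure lborel {y \<in> ball 0 1. ?r y \<le> (1 / 2) ^ k}"
      by (intro emeasure_mono) (auto intro: order_trans)
    also have "\<dots> \<le> ennreal (C * ((1 / 2) ^ k) ^ d)"
      by (rule C2) (auto simp: power_le_one)
    also have "\<dots> \<le> ennreal (C * (1 / 2) ^ k)"
    proof -
      have "((1 / 2 :: real) ^ k) ^ d \<le> ((1 / 2) ^ k) ^ 1"
        using d0 by (intro power_decreasing) (auto simp: power_le_one)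
      then show ?thesis using C by (intro ennreal_leI mult_left_mono) auto
    qed
    finally show ?thesis .
  qed
  have "(\<lambda>k::nat. C * (1 / 2) ^ k) \<longlonglongrightarrow> C * 0"
    by (intro tendsto_mult tendsto_const LIMSEQ_power_zero) auto
  then have "(\<lambda>k. ennreal (C * (1 / 2) ^ k)) \<longlonglongrightarrow> ennreal 0"
    by (intro tendsto_ennrealI) simp
  then have "emeasure lborel ?Z \<le> ennreal 0"
    using le by (intro LIMSEQ_le_const) auto
  then have "?Z \<in> null_sets lborel" using Z by auto
  from AE_not_in[OF this] show ?thesis
    by eventually_elim (auto simp: not_le)
qed

section \<open>The rough kernel\<close>

text \<open>
  Together with the homogeneity of the distance to the plane, this reduces integrals over the sphere
  to integrals over the ball.
\<close>
lemma nn_integral_sphere_measure: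
  fixes f :: "'a::euclidean_space \<Rightarrow> ennreal"
  assumes f: "f \<in> borel_measurable borel"
  shows "nn_integral sphere_measure f =
    of_nat DIM('a) * (\<integral>\<^sup>+ y. f (y /\<^sub>R norm y) * indicator (ball 0 1 - {0}) y \<partial>lborel)"
proof -
  let ?M = "restrict_space (lborel :: 'a measure) (ball 0 1 - {0})"
  have m: "(\<lambda>x. x /\<^sub>R norm x) \<in> measurable ?M (restrict_space borel (sphere 0 1))"
    by (rule measurable_restrict_space2) (auto simp: space_restrict_space intro: measurable_restrict_space1)
  have f': "f \<in> borel_measurable (restrict_space borel (sphere 0 1))"
    using f by (rule measurable_restrict_space1)
  have "nn_integral sphere_measure f =
      of_nat DIM('a) * nn_integral (distr ?M (restrict_space borel (sphere 0 1)) (\<lambda>x. x /\<^sub>R norm x)) f"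
    unfolding sphere_measure_def using f' by (intro nn_integral_scale_measure) simp
  also have "nn_integral (distr ?M (restrict_space borel (sphere 0 1)) (\<lambda>x. x /\<^sub>R norm x)) f
      = (\<integral>\<^sup>+ y. f (y /\<^sub>R norm y) \<partial>?M)"
    using m f' by (intro nn_integral_distr) simp_all
  also have "\<dots> = (\<integral>\<^sup>+ y. f (y /\<^sub>R norm y) * indicator (ball 0 1 - {0}) y \<partial>lborel)"
    by (rule nn_integral_restrict_space) simp
  finally show ?thesis .
qed

text \<open>
  For a unit vector \<open>\<theta>\<close> and \<open>\<eta> \<le> 1\<close> the two balls are disjoint, so the term that makes the kernel odd does
  not interfere with the singularity near \<open>\<theta>\<close>.
\<close>
definition rough_kernel :: "'a::euclidean_space ^ 'm::finite \<Rightarrow> real \<Rightarrow> real \<Rightarrow> 'a ^ 'm \<Rightarrow> real" where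
  "rough_kernel \<theta> \<eta> \<beta> y = infdist y (diag_plane \<theta>) powr (- \<beta>) *
     (indicator (ball \<theta> \<eta>) y - indicator (ball (- \<theta>) \<eta>) y)"

lemma infdist_diag_plane_scaleR:
  "c \<noteq> 0 \<Longrightarrow> infdist (c *\<^sub>R y) (diag_plane \<theta>) = \<bar>c\<bar> * infdist y (diag_plane \<theta>)"
  by (intro infdist_scaleR_cone diag_plane_scaleR)

lemma infdist_normalized:
  assumes "y \<noteq> 0"
  shows "infdist (y /\<^sub>R norm y) (diag_plane \<theta>) = infdist y (diag_plane \<theta>) / norm y"
  using assms by (simp add: infdist_diag_plane_scaleR divide_inverse mult.commute)

lemma rough_kernel_minus: "rough_kernel \<theta> \<eta> \<beta> (- y) = - rough_kernel \<theta> \<eta> \<beta> y"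
proof -
  have "infdist (- y) (diag_plane \<theta>) = infdist y (diag_plane \<theta>)"
    using infdist_diag_plane_scaleR[of "-1" y \<theta>] by simp
  moreover have "- y \<in> ball z \<eta> \<longleftrightarrow> y \<in> ball (- z) \<eta>" for z
    by (simp add: dist_norm norm_minus_commute add.commute)
  ultimately show ?thesis
    by (auto simp: rough_kernel_def indicator_def algebra_simps)
qed

lemma rough_kernel_neq_0D: "rough_kernel \<theta> \<eta> \<beta> y \<noteq> 0 \<Longrightarrow> y \<in> ball \<theta> \<eta> \<or> - y \<in> ball \<theta> \<eta>"
  by (auto simp: rough_kernel_def indicator_def dist_norm norm_minus_commute add.commute split: if_splits)

lemma abs_rough_kernel_le: "\<bar>rough_kernel \<theta> \<eta> \<beta> y\<bar> \<le> infdist y (diag_plane \<theta>) powr (- \<beta>)"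
  by (auto simp: rough_kernel_def indicator_def abs_mult)

lemma rough_kernel_eq:
  assumes "norm \<theta> = 1" "\<eta> \<le> 1" "y \<in> ball \<theta> \<eta>"
  shows "rough_kernel \<theta> \<eta> \<beta> y = infdist y (diag_plane \<theta>) powr (- \<beta>)"
proof -
  have "y \<notin> ball (- \<theta>) \<eta>"
  proof
    assume "y \<in> ball (- \<theta>) \<eta>"
    then have "dist \<theta> (- \<theta>) < 2"
      using assms dist_triangle[of \<theta> "- \<theta>" y] by (auto simp: dist_commute)
    moreover have "\<theta> - (- \<theta>) = 2 *\<^sub>R \<theta>" by (simp add: scaleR_2)
    ultimately show False using assms by (simp add: dist_norm)
  qed
  then show ?thesis using assms by (simp add: rough_kernel_def)
qed

lemma borel_measurable_rough_kernel [measurable]: "rough_kernel \<theta> \<eta> \<beta> \<in> borel_measurable borel"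
proof -
  have [measurable]: "ball z \<eta> \<in> sets borel" for z :: "'a ^ 'b" by simp
  show ?thesis unfolding rough_kernel_def[abs_def] by measurable
qed

text \<open>
  Moving a point of the unit ball radially to the sphere can only increase its distance to a linear
  subspace.
\<close>
lemma infdist_radial_powr_le:
  assumes "y \<noteq> 0" "norm y \<le> 1" "\<beta> \<ge> 0"
  shows "infdist (y /\<^sub>R norm y) (diag_plane \<theta>) powr (- \<beta>) \<le> infdist y (diag_plane \<theta>) powr (- \<beta>)"
proof -
  note eq = infdist_normalized[OF assms(1), of \<theta>]
  show ?thesis
  proof (cases "infdist y (diag_plane \<theta>) = 0")
    case False
    then have pos: "infdist y (diag_plane \<theta>) > 0" using infdist_nonneg[of y "diag_plane \<theta>"] by simp
    have "infdist y (diag_plane \<theta>) \<le> infdist y (diag_plane \<theta>) / norm y"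
      using assms pos by (simp add: field_simps mult_left_le)
    then show ?thesis unfolding eq using pos assms by (intro powr_mono2') auto
  qed (simp add: eq)
qed

lemma in_Lp_rough_kernel:
  fixes \<theta> :: "'a::euclidean_space ^ 'm::finite"
  assumes \<theta>: "norm \<theta> = 1" and ij: "\<theta> $ i \<noteq> \<theta> $ j"
    and d: "CARD('m) * DIM('a) = DIM('a) + 1 + d"
    and \<beta>: "0 \<le> \<beta>" and q: "0 < q" "\<beta> * q < real d"
  shows "in_Lp q sphere_measure (\<lambda>y. complex_of_real (rough_kernel \<theta> \<eta> \<beta> y))"
proof -
  let ?r = "\<lambda>y. infdist y (diag_plane \<theta>)"
  let ?K = "rough_kernel \<theta> \<eta> \<beta>"
  have meas: "(\<lambda>y. complex_of_real (?K y)) \<in> borel_measurable sphere_measure"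
    unfolding measurable_cong_sets[OF sets_sphere_measure refl]
    by (rule measurable_restrict_space1) measurable
  have "(\<integral>\<^sup>+ y. ennreal (norm (complex_of_real (?K y)) powr q) \<partial>sphere_measure)
      = of_nat DIM('a ^ 'm) * (\<integral>\<^sup>+ y. ennreal (norm (complex_of_real (?K (y /\<^sub>R norm y))) powr q)
          * indicator (ball 0 1 - {0}) y \<partial>lborel)"
    by (rule nn_integral_sphere_measure) measurable
  also have "\<dots> \<le> of_nat DIM('a ^ 'm) *
      (\<integral>\<^sup>+ y. ennreal (?r y powr (- (\<beta> * q))) * indicator (ball 0 1) y \<partial>lborel)"
  proof (intro mult_left_mono nn_integral_mono)
    fix y :: "'a ^ 'm"
    show "ennreal (norm (complex_of_real (?K (y /\<^sub>R norm y))) powr q) * indicator (ball 0 1 - {0}) y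
        \<le> ennreal (?r y powr (- (\<beta> * q))) * indicator (ball 0 1) y"
    proof (cases "y \<in> ball 0 1 - {0}")
      case True
      then have y: "y \<noteq> 0" "norm y \<le> 1" by auto
      have "\<bar>?K (y /\<^sub>R norm y)\<bar> \<le> ?r y powr (- \<beta>)"
        using abs_rough_kernel_le infdist_radial_powr_le[OF y \<beta>] by (rule order_trans)
      then have "\<bar>?K (y /\<^sub>R norm y)\<bar> powr q \<le> (?r y powr (- \<beta>)) powr q"
        using q by (intro powr_mono2) auto
      then show ?thesis using True by (simp add: powr_powr ennreal_leI)
    qed auto
  qed auto
  also have "\<dots> < \<infinity>"
    using nn_integral_infdist_diag_plane_finite[OF \<theta> ij d, of "\<beta> * q"] \<beta> q
    by (simp add: ennreal_mult_less_top of_nat_less_top)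
  finally show ?thesis
    using meas by (simp add: in_Lp_def Lp_norm_def Let_def)
qed

text \<open>
  If the integrand vanishes near the origin, the truncated integrals are eventually constant.
\<close>
lemma singular_integral_eq_integral:
  assumes c: "c > 0" and zero: "\<And>y. norm y \<le> c \<Longrightarrow> (\<Prod>i\<in>UNIV. f i (x - y $ i)) = 0"
  shows "singular_integral \<Omega> f x =
    (LINT y|lborel. \<Omega> (y /\<^sub>R norm y) / of_real (norm y ^ (CARD('m) * DIM('a))) *
      (\<Prod>i\<in>UNIV. f i (x - (y :: 'a::euclidean_space ^ 'm::finite) $ i)))" (is "_ = integral\<^sup>L lborel ?F")
  unfolding singular_integral_def
proof (rule tendsto_Lim)
  have "eventually (\<lambda>\<epsilon>::real. \<epsilon> < c) (at_right 0)"
    using c eventually_at_right_less[of 0] eventually_at_right_real[of 0 c] by (auto elim: eventually_mono)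
  then have "eventually (\<lambda>\<epsilon>. (LINT y : {y. \<epsilon> < norm y} | lborel. ?F y) = integral\<^sup>L lborel ?F) (at_right 0)"
  proof eventually_elim
    case (elim \<epsilon>)
    have "indicat_real {y. \<epsilon> < norm y} y *\<^sub>R ?F y = ?F y" for y
      using zero[of y] elim by (cases "\<epsilon> < norm y") auto
    then show ?case unfolding set_lebesgue_integral_def by simp
  qed
  then show "((\<lambda>\<epsilon>. LINT y : {y. \<epsilon> < norm y} | lborel. ?F y) \<longlongrightarrow> integral\<^sup>L lborel ?F) (at_right 0)"
    by (rule tendsto_eventually)
qed simp

lemma norm_diag_le: "norm ((\<chi> i. x) :: 'a::euclidean_space ^ 'm::finite) \<le> real CARD('m) * norm x"
  using L2_set_le_sum[of UNIV "\<lambda>_::'m. norm x"] by (simp add: norm_vec_def)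

text \<open>
  Both vectors are compared with \<open>2y\<close>, which is close to \<open>\<theta>\<close> and has norm close to \<open>1\<close>.
\<close>
lemma radial_projection_close:
  fixes y \<theta> :: "'a::real_normed_vector"
  assumes \<theta>: "norm \<theta> = 1" and y: "norm (y - (1 / 2) *\<^sub>R \<theta>) \<le> \<kappa>" "y \<noteq> 0"
  shows "norm (y /\<^sub>R norm y - \<theta>) \<le> 4 * \<kappa>"
proof -
  have n: "\<bar>norm y - 1 / 2\<bar> \<le> \<kappa>"
    using norm_triangle_ineq3[of y "(1 / 2) *\<^sub>R \<theta>"] y \<theta> by simp
  have "norm (y /\<^sub>R norm y - 2 *\<^sub>R y) = \<bar>inverse (norm y) - 2\<bar> * norm y"
    unfolding scaleR_left_diff_distrib[symmetric] by simp
  also have "\<dots> = \<bar>(inverse (norm y) - 2) * norm y\<bar>" by (simp add: abs_mult)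
  also have "\<dots> = \<bar>1 - 2 * norm y\<bar>" using y by (simp add: algebra_simps)
  also have "\<dots> \<le> 2 * \<kappa>" using n by linarith
  finally have 1: "norm (y /\<^sub>R norm y - 2 *\<^sub>R y) \<le> 2 * \<kappa>" .
  have "2 *\<^sub>R y - \<theta> = 2 *\<^sub>R (y - (1 / 2) *\<^sub>R \<theta>)" by (simp add: algebra_simps)
  then have 2: "norm (2 *\<^sub>R y - \<theta>) \<le> 2 * \<kappa>" using y by simp
  show ?thesis
    using norm_triangle_ineq[of "y /\<^sub>R norm y - 2 *\<^sub>R y" "2 *\<^sub>R y - \<theta>"] 1 2 by simp
qed

text \<open>
  With bumps centred at \<open>-\<theta>\<^sub>i/2\<close> the integrand is supported in a cube of side \<open>2\<delta>\<close> around
  \<open>z = (x + \<theta>\<^sub>i/2)\<^sub>i\<close>, a point of the plane, and \<open>z\<close> is close to \<open>\<theta>/2\<close> since \<open>x\<close> is small. Hence the directions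
  \<open>y/|y|\<close> stay in the ball where the kernel is positive, and their distance to the plane is at most \<open>4 m n \<delta>\<close>.
  Halving \<open>\<theta>\<close> keeps the cube inside the unit ball and away from the origin.
\<close>
lemma singular_integral_cube_bumps_ge:
  fixes \<theta> :: "'a::euclidean_space ^ 'm::finite"
  assumes \<theta>: "norm \<theta> = 1" and ij: "\<theta> $ i \<noteq> \<theta> $ j"
    and d: "CARD('m) * DIM('a) = DIM('a) + 1 + d" and d0: "d > 0"
    and \<beta>: "0 \<le> \<beta>" "\<beta> < real d" and \<eta>: "0 < \<eta>" "\<eta> \<le> 1"
    and \<delta>: "0 < \<delta>" "real (CARD('m) * DIM('a)) * \<delta> \<le> \<eta> / 10"
    and x: "real CARD('m) * norm x \<le> \<eta> / 10"
  shows "norm (singular_integral (\<lambda>y. complex_of_real (rough_kernel \<theta> \<eta> \<beta> y))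
      (\<lambda>i x. complex_of_real (cube_bump (- ((1 / 2) *\<^sub>R \<theta> $ i)) \<delta> x)) x)
    \<ge> (4 * real (CARD('m) * DIM('a))) powr (- \<beta>) * exp (- 2) ^ (CARD('m) * DIM('a))
       * \<delta> powr (real (CARD('m) * DIM('a)) - \<beta>)"
proof -
  define N where "N = CARD('m) * DIM('a)"
  have N0: "N > 0" by (simp add: N_def)
  have DIM_N: "DIM('a ^ 'm) = N" by (simp add: N_def)
  let ?r = "\<lambda>y. infdist y (diag_plane \<theta>)"
  \<comment> \<open>The product of the inputs; \<open>G\<close> is the integrand.\<close>
  define B where "B y = (\<Prod>i\<in>UNIV. cube_bump (- ((1 / 2) *\<^sub>R \<theta> $ i)) \<delta> (x - y $ i))" for y :: "'a ^ 'm"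
  define G where "G y = rough_kernel \<theta> \<eta> \<beta> (y /\<^sub>R norm y) / norm y ^ N * B y" for y
  define z where "z = (\<chi> i. x + (1 / 2) *\<^sub>R \<theta> $ i)"
  have zL: "z \<in> diag_plane \<theta>" unfolding z_def diag_plane_def by blast
  have zdiff: "x - y $ i - - ((1 / 2) *\<^sub>R \<theta> $ i) = - ((y - z) $ i)" for y i
    by (simp add: z_def)
  have B_bounds: "0 \<le> B y" "B y \<le> 1" for y
    unfolding B_def by (auto intro!: prod_nonneg prod_le_1 simp: cube_bump_nonneg cube_bump_le_1)
  have supp: "norm (y - z) \<le> real N * \<delta>" if "B y \<noteq> 0" for y
  proof -
    have "\<forall>i. cube_bump (- ((1 / 2) *\<^sub>R \<theta> $ i)) \<delta> (x - y $ i) \<noteq> 0"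
      using that unfolding B_def by (simp add: prod_zero_iff)
    then have "\<forall>i. \<forall>e\<in>Basis. \<bar>(y - z) $ i \<bullet> e\<bar> < \<delta>"
      using cube_bump_neq_0D[OF _ \<delta>(1)] zdiff by (metis abs_minus_cancel inner_minus_left)
    then have "\<forall>b\<in>Basis. \<bar>(y - z) \<bullet> b\<bar> < \<delta>"
      using inner_Basis_vec_iff[of "\<lambda>t. \<bar>t\<bar> < \<delta>" "y - z"] by blast
    then have "(\<Sum>b\<in>Basis. \<bar>(y - z) \<bullet> b\<bar>) \<le> real DIM('a ^ 'm) * \<delta>"
      by (intro sum_bounded_above) (auto intro: less_imp_le)
    then show ?thesis using norm_le_l1[of "y - z"] unfolding DIM_N by linarith
  qed
  \<comment> \<open>By \<open>radial_projection_close\<close> this moves the direction of \<open>y\<close> away from \<open>\<theta>\<close> by at most \<open>4\<eta>/5\<close>.\<close>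
  have near: "norm (y - (1 / 2) *\<^sub>R \<theta>) \<le> \<eta> / 5" if "B y \<noteq> 0" for y
  proof -
    have "z - (1 / 2) *\<^sub>R \<theta> = (\<chi> i. x)" by (simp add: z_def vec_eq_iff)
    then have "norm (z - (1 / 2) *\<^sub>R \<theta>) \<le> \<eta> / 10"
      using norm_diag_le[where 'm='m, of x] x by simp
    moreover have "norm (y - z) \<le> \<eta> / 10" using supp[OF that] \<delta> by (simp add: N_def)
    ultimately show ?thesis
      using norm_triangle_ineq[of "y - z" "z - (1 / 2) *\<^sub>R \<theta>"] by simp
  qed
  have norm_y: "1 / 4 < norm y" "norm y < 1" if "B y \<noteq> 0" for y
    using norm_triangle_ineq3[of y "(1 / 2) *\<^sub>R \<theta>"] near[OF that] \<theta> \<eta> by auto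
  have G_eq: "G y = ?r (y /\<^sub>R norm y) powr (- \<beta>) / norm y ^ N * B y" for y
  proof (cases "B y = 0")
    case False
    have "norm (y /\<^sub>R norm y - \<theta>) \<le> 4 * (\<eta> / 5)"
      using norm_y[OF False] by (intro radial_projection_close[OF \<theta> near[OF False]]) auto
    then have "y /\<^sub>R norm y \<in> ball \<theta> \<eta>" using \<eta> by (simp add: dist_norm norm_minus_commute)
    then show ?thesis by (simp add: G_def rough_kernel_eq[OF \<theta> \<eta>(2)])
  qed (simp add: G_def)
  have G_nonneg: "G y \<ge> 0" for y
    unfolding G_eq using B_bounds by simp
  have B_meas: "B \<in> borel_measurable borel"
  proof -
    have "continuous_on UNIV B"
      unfolding B_def
      by (intro continuous_on_prod continuous_on_compose2[OF continuous_cube_bump] continuous_intros) auto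
    then show ?thesis by (rule borel_measurable_continuous_onI)
  qed
  have G_meas: "G \<in> borel_measurable lborel"
    unfolding G_def[abs_def] using B_meas by measurable
  have G_le: "G y \<le> 4 ^ N * (?r y powr (- \<beta>) * indicator (ball 0 1) y)" for y
  proof (cases "B y = 0")
    case False
    note ny = norm_y[OF False]
    have "1 / norm y \<le> 4" using ny by (simp add: divide_le_eq)
    then have "1 / norm y ^ N \<le> 4 ^ N"
      using power_mono[of "1 / norm y" 4 N] by (simp add: power_one_over)
    then have "?r (y /\<^sub>R norm y) powr (- \<beta>) * (1 / norm y ^ N) * B y \<le> ?r y powr (- \<beta>) * 4 ^ N * 1"
      using ny B_bounds \<beta>(1) by (intro mult_mono infdist_radial_powr_le) auto
    then show ?thesis using ny by (simp add: G_eq mult_ac)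
  qed (simp add: G_eq)
  have G_int: "integrable lborel G"
  proof (rule integrableI_bounded[OF G_meas])
    have [measurable]: "ball (0 :: 'a ^ 'm) 1 \<in> sets borel" by simp
    have "(\<integral>\<^sup>+ y. ennreal (norm (G y)) \<partial>lborel)
        \<le> (\<integral>\<^sup>+ y. ennreal (4 ^ N) * (ennreal (?r y powr (- \<beta>)) * indicator (ball 0 1) y) \<partial>lborel)"
    proof (rule nn_integral_mono)
      fix y
      have "ennreal (norm (G y)) \<le> ennreal (4 ^ N * (?r y powr (- \<beta>) * indicator (ball 0 1) y))"
        using G_nonneg G_le by (simp add: ennreal_leI)
      then show "ennreal (norm (G y)) \<le> ennreal (4 ^ N) * (ennreal (?r y powr (- \<beta>)) * indicator (ball 0 1) y)"
        by (cases "y \<in> ball 0 1") (simp_all add: ennreal_mult)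
    qed
    also have "\<dots> = ennreal (4 ^ N) * (\<integral>\<^sup>+ y. ennreal (?r y powr (- \<beta>)) * indicator (ball 0 1) y \<partial>lborel)"
      by (rule nn_integral_cmult) measurable
    also have "\<dots> < \<infinity>"
      using nn_integral_infdist_diag_plane_finite[OF \<theta> ij d \<beta>] by (simp add: ennreal_mult_less_top)
    finally show "(\<integral>\<^sup>+ y. ennreal (norm (G y)) \<partial>lborel) < \<infinity>" .
  qed
  define c where "c = (4 * real N * \<delta>) powr (- \<beta>) * exp (- 2) ^ N"
  let ?Q = "cbox (z - (\<delta> / 2) *\<^sub>R One) (z + (\<delta> / 2) *\<^sub>R One)"
  \<comment> \<open>On the cube of half the size around \<open>z\<close> the bumps are bounded below.\<close>
  have lower: "AE y in lborel. c * indicator ?Q y \<le> G y"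
    using AE_infdist_diag_plane_pos[OF \<theta> ij d d0]
  proof eventually_elim
    case (elim y)
    show ?case
    proof (cases "y \<in> ?Q")
      case True
      then have "\<forall>b\<in>Basis. \<bar>(y - z) \<bullet> b\<bar> \<le> \<delta> / 2"
        unfolding mem_cbox_cube_iff .
      then have "\<forall>i. \<forall>e\<in>Basis. \<bar>(y - z) $ i \<bullet> e\<bar> \<le> \<delta> / 2"
        using inner_Basis_vec_iff[of "\<lambda>t. \<bar>t\<bar> \<le> \<delta> / 2" "y - z"] by blast
      then have "cube_bump (- ((1 / 2) *\<^sub>R \<theta> $ i)) \<delta> (x - y $ i) \<ge> exp (- 2) ^ DIM('a)" for i
        using \<delta>(1) by (intro cube_bump_ge) (simp_all only: zdiff inner_minus_left abs_minus_cancel)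
      then have "(\<Prod>i\<in>(UNIV::'m set). exp (- 2) ^ DIM('a)) \<le> B y"
        unfolding B_def by (intro prod_mono) auto
      then have B_ge: "exp (- 2) ^ N \<le> B y"
        by (simp add: N_def power_mult[symmetric] mult.commute)
      moreover have "(0::real) < exp (- 2) ^ N" by simp
      ultimately have nz: "B y \<noteq> 0" by linarith
      note ny = norm_y[OF nz]
      have r0: "?r y > 0" using elim ny by simp
      have "?r y \<le> real N * \<delta>"
        using infdist_le[OF zL, of y] supp[OF nz] by (simp add: dist_norm)
      then have "?r y / norm y \<le> real N * \<delta> / (1 / 4)"
        using ny r0 by (intro frac_le) auto
      moreover have req: "?r (y /\<^sub>R norm y) = ?r y / norm y"
        using ny by (intro infdist_normalized) auto
      ultimately have r1: "?r (y /\<^sub>R norm y) \<le> 4 * real N * \<delta>" by simp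
      have r2: "0 < ?r (y /\<^sub>R norm y)" unfolding req using r0 ny by (intro divide_pos_pos; linarith)
      have "(4 * real N * \<delta>) powr (- \<beta>) \<le> ?r (y /\<^sub>R norm y) powr (- \<beta>)"
        using r1 r2 \<beta> by (intro powr_mono2') auto
      moreover have "1 \<le> 1 / norm y ^ N"
      proof -
        have "0 < norm y ^ N" using ny by (intro zero_less_power) linarith
        moreover have "norm y ^ N \<le> 1" using ny by (intro power_le_one) auto
        ultimately show ?thesis by simp
      qed
      ultimately have "(4 * real N * \<delta>) powr (- \<beta>) * 1 * exp (- 2) ^ N
          \<le> ?r (y /\<^sub>R norm y) powr (- \<beta>) * (1 / norm y ^ N) * B y"
        using B_ge by (intro mult_mono) auto
      then show ?thesis using True by (simp add: G_eq c_def)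
    qed (simp add: G_nonneg)
  qed
  have volQ: "emeasure lborel ?Q = ennreal (\<delta> ^ N)"
    using \<delta> by (subst emeasure_lborel_cbox) (auto simp: inner_diff_left inner_add_left DIM_N N_def)
  have Q_int: "integrable lborel (\<lambda>y. c * indicator ?Q y)"
    by (intro integrable_mult_right integrable_real_indicator) (auto simp: volQ)
  have "c * \<delta> ^ N = (LINT y|lborel. c * indicator ?Q y)"
    using volQ \<delta> by (simp add: measure_def)
  also have "\<dots> \<le> integral\<^sup>L lborel G"
    by (rule integral_mono_AE[OF Q_int G_int lower])
  finally have G_ge: "c * \<delta> ^ N \<le> integral\<^sup>L lborel G" .
  have c_eq: "c * \<delta> ^ N = (4 * real N) powr (- \<beta>) * exp (- 2) ^ N * \<delta> powr (real N - \<beta>)"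
  proof -
    have "\<delta> powr (real N - \<beta>) = \<delta> powr (- \<beta>) * \<delta> ^ N"
      using powr_add[of \<delta> "- \<beta>" "real N"] powr_realpow[OF \<delta>(1), of N] by simp
    moreover have "(4 * real N * \<delta>) powr (- \<beta>) = (4 * real N) powr (- \<beta>) * \<delta> powr (- \<beta>)"
      using \<delta>(1) by (intro powr_mult)
    ultimately show ?thesis by (simp add: c_def)
  qed
  have "singular_integral (\<lambda>y. complex_of_real (rough_kernel \<theta> \<eta> \<beta> y))
      (\<lambda>i x. complex_of_real (cube_bump (- ((1 / 2) *\<^sub>R \<theta> $ i)) \<delta> x)) x
    = (LINT y|lborel. complex_of_real (rough_kernel \<theta> \<eta> \<beta> (y /\<^sub>R norm y)) /
         of_real (norm y ^ (CARD('m) * DIM('a))) *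
         (\<Prod>i\<in>UNIV. complex_of_real (cube_bump (- ((1 / 2) *\<^sub>R \<theta> $ i)) \<delta> (x - y $ i))))"
  proof (rule singular_integral_eq_integral)
    show "(\<Prod>i\<in>UNIV. complex_of_real (cube_bump (- ((1 / 2) *\<^sub>R \<theta> $ i)) \<delta> (x - y $ i))) = 0"
      if "norm y \<le> 1 / 4" for y
      using norm_y(1)[of y] that unfolding of_real_prod[symmetric] B_def[symmetric] by force
  qed simp
  also have "\<dots> = (LINT y|lborel. complex_of_real (G y))"
    by (simp add: G_def B_def N_def)
  also have "\<dots> = complex_of_real (integral\<^sup>L lborel G)" by simp
  finally have "norm (singular_integral (\<lambda>y. complex_of_real (rough_kernel \<theta> \<eta> \<beta> y))
      (\<lambda>i x. complex_of_real (cube_bump (- ((1 / 2) *\<^sub>R \<theta> $ i)) \<delta> x)) x) = \<bar>integral\<^sup>L lborel G\<bar>"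
    by simp
  then show ?thesis using G_ge c_eq unfolding N_def by linarith
qed

section \<open>Unboundedness\<close>

lemma Lp_norm_ge:
  assumes A: "A \<ge> 0" "\<And>x. x \<in> S \<Longrightarrow> A \<le> norm (f x)" and p: "p > 0"
    and S: "S \<in> sets M" "emeasure M S = ennreal v" "v \<ge> 0"
  shows "ennreal (A * v powr (1 / p)) \<le> Lp_norm p M f"
proof -
  define I where "I = (\<integral>\<^sup>+ x. ennreal (norm (f x) powr p) \<partial>M)"
  have "ennreal (A powr p * v) = (\<integral>\<^sup>+ x. ennreal (A powr p) * indicator S x \<partial>M)"
    using S by (subst nn_integral_cmult_indicator) (auto simp: ennreal_mult)
  also have "\<dots> \<le> I"
    unfolding I_def
  proof (rule nn_integral_mono)
    fix x show "ennreal (A powr p) * indicator S x \<le> ennreal (norm (f x) powr p)"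
      using A p by (cases "x \<in> S") (auto intro!: ennreal_leI powr_mono2)
  qed
  finally have I: "ennreal (A powr p * v) \<le> I" .
  show ?thesis
  proof (cases "I = \<infinity>")
    case False
    then have "A powr p * v \<le> enn2real I"
      using I S by (metis enn2real_ennreal enn2real_mono infinity_ennreal_def less_top mult_nonneg_nonneg powr_ge_zero)
    then have "(A powr p * v) powr (1 / p) \<le> enn2real I powr (1 / p)"
      using p S by (intro powr_mono2) auto
    moreover have "(A powr p * v) powr (1 / p) = A * v powr (1 / p)"
      using A p S by (simp add: powr_mult powr_powr)
    ultimately show ?thesis
      using False unfolding Lp_norm_def I_def[symmetric] Let_def by (simp add: ennreal_leI)
  qed (simp add: Lp_norm_def I_def Let_def)
qed

lemma prod_mono_ennreal:
  fixes f g :: "'i \<Rightarrow> ennreal"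
  shows "(\<And>i. i \<in> A \<Longrightarrow> f i \<le> g i) \<Longrightarrow> prod f A \<le> prod g A"
  by (induction A rule: infinite_finite_induct) (auto intro!: mult_mono)

lemma exists_small_scale:
  fixes a b \<gamma> \<delta>0 :: real
  assumes "a > 0" "\<gamma> > 0" "\<delta>0 > 0"
  obtains \<delta> where "0 < \<delta>" "\<delta> < \<delta>0" "b * \<delta> powr \<gamma> < a"
proof -
  have "((\<lambda>\<delta>. \<delta> powr \<gamma>) \<longlongrightarrow> 0) (at_right 0)"
    using assms by (intro tendsto_zero_powrI[where b = \<gamma>] tendsto_intros)
      (auto simp: eventually_at_right_less intro: eventually_mono[OF eventually_at_right_less])
  then have "((\<lambda>\<delta>. b * \<delta> powr \<gamma>) \<longlongrightarrow> b * 0) (at_right 0)"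
    by (intro tendsto_intros)
  then have "eventually (\<lambda>\<delta>. b * \<delta> powr \<gamma> < a) (at_right 0)"
    using assms by (auto dest: order_tendstoD(2))
  moreover have "eventually (\<lambda>\<delta>. \<delta> \<in> {0<..<\<delta>0}) (at_right 0)"
    using assms by (intro eventually_at_right_real)
  ultimately have "eventually (\<lambda>\<delta>. 0 < \<delta> \<and> \<delta> < \<delta>0 \<and> b * \<delta> powr \<gamma> < a) (at_right 0)"
    by eventually_elim auto
  then have "\<exists>\<delta>. 0 < \<delta> \<and> \<delta> < \<delta>0 \<and> b * \<delta> powr \<gamma> < a"
    using eventually_happens'[of "at_right (0::real)"] by simp
  then show thesis using that by blast
qed

text \<open>
  Testing on bumps of width \<open>\<delta>\<close>: the output has size at least of order \<open>\<delta>\<close> to the power \<open>m n - \<beta>\<close> on a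
  fixed ball, and the hypothesis \<open>gap\<close> says that this exponent is smaller than the exponent \<open>n / p\<close> of
  the inputs.
\<close>
lemma not_multilinear_bounded_rough_kernel:
  fixes \<theta> :: "'a::euclidean_space ^ 'm::finite"
  assumes \<theta>: "norm \<theta> = 1" and ij: "\<theta> $ i \<noteq> \<theta> $ j"
    and d: "CARD('m) * DIM('a) = DIM('a) + 1 + d" and d0: "d > 0"
    and \<beta>: "0 \<le> \<beta>" "\<beta> < real d" and \<eta>: "0 < \<eta>" "\<eta> \<le> 1"
    and P: "\<And>i. 1 < P i" and p: "1 / p = (\<Sum>i\<in>UNIV. 1 / P i)"
    and gap: "real (CARD('m) * DIM('a)) - \<beta> < real DIM('a) / p"
  shows "\<not> multilinear_bounded
    (singular_integral (\<lambda>y::'a ^ 'm. complex_of_real (rough_kernel \<theta> \<eta> \<beta> y))) P p"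
    (is "\<not> multilinear_bounded ?T P p")
proof
  assume "multilinear_bounded ?T P p"
  then obtain C0 where C0: "\<And>f. (\<And>i. schwartz (f i)) \<Longrightarrow>
      Lp_norm p lborel (?T f) \<le> ennreal C0 * (\<Prod>i\<in>UNIV. Lp_norm (P i) lborel (f i))"
    unfolding multilinear_bounded_def by blast
  define C where "C = max C0 0"
  define N where "N = CARD('m) * DIM('a)"
  \<comment> \<open>The radius of the fixed ball on which the output is bounded below.\<close>
  define r where "r = \<eta> / (10 * real CARD('m))"
  have N0: "N > 0" by (simp add: N_def)
  have r0: "r > 0" using \<eta> by (simp add: r_def)
  have "1 / p > 0" unfolding p using P by (intro sum_pos) (auto intro: order_less_trans[OF zero_less_one])
  then have p0: "p > 0" by (simp add: zero_less_divide_iff)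
  define v where "v = measure lborel (ball (0::'a) r)"
  have v: "emeasure lborel (ball (0::'a) r) = ennreal v"
    unfolding v_def by (rule emeasure_eq_ennreal_measure) (use emeasure_bounded_finite[of "ball (0::'a) r"] in auto)
  have v0: "v > 0" unfolding v_def using r0 by (simp add: content_ball_pos)
  define c where "c = (4 * real N) powr (- \<beta>) * exp (- 2) ^ N"
  have c0: "c > 0" using N0 by (simp add: c_def)
  define \<gamma> where "\<gamma> = real DIM('a) / p - (real N - \<beta>)"
  have \<gamma>0: "\<gamma> > 0" using gap by (simp add: \<gamma>_def N_def)
  \<comment> \<open>Small enough for the lower bound to apply and to contradict the supposed estimate.\<close>
  obtain \<delta> where \<delta>: "0 < \<delta>" "\<delta> < \<eta> / (10 * real N)"
      "C * 2 powr (real DIM('a) / p) * \<delta> powr \<gamma> < c * v powr (1 / p)"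
    by (rule exists_small_scale[of "c * v powr (1 / p)" \<gamma> "\<eta> / (10 * real N)" "C * 2 powr (real DIM('a) / p)"])
      (use c0 v0 \<gamma>0 \<eta> N0 in auto)
  define f where "f i x = complex_of_real (cube_bump (- ((1 / 2) *\<^sub>R \<theta> $ i)) \<delta> x)" for i x
  have "ennreal (c * \<delta> powr (real N - \<beta>) * v powr (1 / p)) \<le> Lp_norm p lborel (?T f)"
  proof (rule Lp_norm_ge[OF _ _ p0 _ v])
    fix x :: 'a assume "x \<in> ball 0 r"
    then have x: "real CARD('m) * norm x \<le> \<eta> / 10"
      by (simp add: r_def field_simps)
    have \<delta>': "real (CARD('m) * DIM('a)) * \<delta> \<le> \<eta> / 10"
    proof -
      have "real N * \<delta> \<le> \<eta> / 10" using \<delta>(2) N0 by (simp add: field_simps)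
      then show ?thesis by (simp only: N_def)
    qed
    show "c * \<delta> powr (real N - \<beta>) \<le> norm (?T f x)"
      using singular_integral_cube_bumps_ge[OF \<theta> ij d d0 \<beta> \<eta> \<delta>(1) \<delta>' x]
      unfolding f_def[abs_def] c_def N_def .
  qed (use c0 v0 in auto)
  also have "\<dots> \<le> ennreal C0 * (\<Prod>i\<in>UNIV. Lp_norm (P i) lborel (f i))"
    by (rule C0) (auto simp: f_def[abs_def] intro: schwartz_cube_bump[OF \<delta>(1)])
  also have "\<dots> \<le> ennreal C * (\<Prod>i\<in>(UNIV::'m set). ennreal ((2 * \<delta>) powr (real DIM('a) / P i)))"
  proof (intro mult_mono prod_mono_ennreal)
    fix i show "Lp_norm (P i) lborel (f i) \<le> ennreal ((2 * \<delta>) powr (real DIM('a) / P i))"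
      unfolding f_def[abs_def] using P[of i] by (intro Lp_norm_cube_bump_le[OF \<delta>(1)]) simp
  qed (auto simp: C_def intro!: ennreal_leI)
  also have "(\<Prod>i\<in>(UNIV::'m set). ennreal ((2 * \<delta>) powr (real DIM('a) / P i)))
      = ennreal ((2 * \<delta>) powr (real DIM('a) / p))"
  proof -
    have "(\<Prod>i\<in>(UNIV::'m set). (2 * \<delta>) powr (real DIM('a) / P i))
        = (2 * \<delta>) powr (\<Sum>i\<in>(UNIV::'m set). real DIM('a) / P i)"
      using \<delta> by (simp add: powr_sum)
    also have "(\<Sum>i\<in>(UNIV::'m set). real DIM('a) / P i) = real DIM('a) / p"
      using p by (simp add: sum_distrib_left[symmetric] divide_inverse)
    finally show ?thesis by (subst prod_ennreal) auto
  qed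
  finally have "ennreal (c * \<delta> powr (real N - \<beta>) * v powr (1 / p))
      \<le> ennreal (C * (2 * \<delta>) powr (real DIM('a) / p))"
    by (simp add: C_def ennreal_mult)
  then have "c * \<delta> powr (real N - \<beta>) * v powr (1 / p) \<le> C * (2 * \<delta>) powr (real DIM('a) / p)"
    by (subst (asm) ennreal_le_iff) (auto simp: C_def)
  also have "(2 * \<delta>) powr (real DIM('a) / p)
      = 2 powr (real DIM('a) / p) * (\<delta> powr \<gamma> * \<delta> powr (real N - \<beta>))"
    using \<delta> by (simp add: powr_mult powr_add[symmetric] \<gamma>_def)
  finally have "(c * v powr (1 / p)) * \<delta> powr (real N - \<beta>)
      \<le> (C * 2 powr (real DIM('a) / p) * \<delta> powr \<gamma>) * \<delta> powr (real N - \<beta>)"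
    by (simp add: mult_ac)
  then show False using \<delta> by (simp add: mult_le_cancel_right)
qed

text \<open>
  The condition on the exponents says exactly that the requirements \<open>m n - n / p < \<beta>\<close> (unboundedness)
  and \<open>\<beta> < d / q\<close> (integrability) leave room for some \<open>\<beta>\<close>.
\<close>
lemma exists_unbounded_rough_singular_integral:
  fixes \<theta> :: "'a::euclidean_space ^ 'm::finite" and P :: "'m \<Rightarrow> real"
  assumes \<theta>: "norm \<theta> = 1" and ij: "\<theta> $ i \<noteq> \<theta> $ j"
    and d: "CARD('m) * DIM('a) = DIM('a) + 1 + d" and d0: "d > 0"
    and U: "open U" "\<theta> \<in> U" "\<And>y. y \<in> U \<Longrightarrow> - y \<in> U"
    and q: "1 < q" and P: "\<And>i. 1 < P i" and p: "1 / p = (\<Sum>i\<in>UNIV. 1 / P i)"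
    and gap: "real (CARD('m) * DIM('a)) - real d / q < real DIM('a) / p"
  shows "\<exists>\<Omega> :: 'a ^ 'm \<Rightarrow> complex. odd_on_sphere \<Omega> \<and> in_Lp q sphere_measure \<Omega> \<and>
    supported_in \<Omega> {y \<in> sphere 0 1. y \<in> U} \<and> \<not> multilinear_bounded (singular_integral \<Omega>) P p"
proof -
  \<comment> \<open>The lower bound \<open>0\<close> ensures that the kernel grows towards the plane.\<close>
  have "max 0 (real (CARD('m) * DIM('a)) - real DIM('a) / p) < real d / q"
    using gap d0 q by simp
  then obtain \<beta> where b: "max 0 (real (CARD('m) * DIM('a)) - real DIM('a) / p) < \<beta>" "\<beta> < real d / q"
    using dense by blast
  have \<beta>: "0 \<le> \<beta>" "\<beta> * q < real d" "real (CARD('m) * DIM('a)) - \<beta> < real DIM('a) / p"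
    using b q by (auto simp: field_simps)
  have "real d / q \<le> real d" using q d0 by (simp add: field_simps)
  then have \<beta>d: "\<beta> < real d" using b by linarith
  obtain e where e: "e > 0" "ball \<theta> e \<subseteq> U" using U by (auto simp: open_contains_ball)
  define \<eta> where "\<eta> = min e 1"
  have \<eta>: "0 < \<eta>" "\<eta> \<le> 1" "ball \<theta> \<eta> \<subseteq> U" using e by (auto simp: \<eta>_def)
  let ?\<Omega> = "\<lambda>y. complex_of_real (rough_kernel \<theta> \<eta> \<beta> y)"
  have "y \<in> U" if "rough_kernel \<theta> \<eta> \<beta> y \<noteq> 0" for y
    using rough_kernel_neq_0D[OF that] \<eta>(3) U(3)[of "- y"] by (metis minus_minus subsetD)
  then have "supported_in ?\<Omega> {y \<in> sphere 0 1. y \<in> U}"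
    unfolding supported_in_def by (intro AE_I2) (force simp: space_sphere_measure)
  moreover have "odd_on_sphere ?\<Omega>"
    by (simp add: odd_on_sphere_def rough_kernel_minus)
  moreover have "in_Lp q sphere_measure ?\<Omega>"
    using in_Lp_rough_kernel[OF \<theta> ij d \<beta>(1) _ \<beta>(2)] q by simp
  moreover have "\<not> multilinear_bounded (singular_integral ?\<Omega>) P p"
    by (rule not_multilinear_bounded_rough_kernel[OF \<theta> ij d d0 \<beta>(1) \<beta>d \<eta>(1,2) P p \<beta>(3)])
  ultimately show ?thesis by blast
qed

text \<open>
  Here \<open>k\<close> stands for \<open>m n\<close>. The relation \<open>k = n + 1 + d\<close> and \<open>q > 1\<close> make the denominator positive.
\<close>
lemma gap_of_exponent_bound:
  fixes k n d q p :: real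
  assumes "p > 0" "q > 1" "n > 0" "d > 0" "k = n + 1 + d"
    and "p < n * q / (k * q - d)"
  shows "k - d / q < n / p"
proof -
  have "d < k * q"
  proof -
    have "d * 1 < k * q" using assms by (intro mult_strict_mono) auto
    then show ?thesis by simp
  qed
  then have "p * (k * q - d) < n * q" using assms by (simp add: pos_less_divide_eq)
  then have "(k - d / q) * p < n" using assms by (simp add: field_simps)
  then show ?thesis using assms by (simp add: pos_less_divide_eq)
qed

theorem theorem3:
  shows
    "(CARD('n::finite) \<ge> 2 \<longrightarrow>
       (\<forall>(P :: 2 \<Rightarrow> real) (p::real) (q::real).
          (\<forall>i. 1 < P i) \<and> 1 / p = 1 / P 1 + 1 / P 2 \<and> 1 < q \<and>
          p < real CARD('n) * q / (1 - real CARD('n) + 2 * real CARD('n) * q) \<longrightarrow>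
          (\<exists>\<Omega> :: (real ^ 'n) ^ 2 \<Rightarrow> complex.
             odd_on_sphere \<Omega> \<and>
             in_Lp q sphere_measure \<Omega> \<and>
             supported_in \<Omega> {\<theta> \<in> sphere 0 1. norm (\<theta> $ 1 - \<theta> $ 2) > 1 / 2} \<and>
             \<not> multilinear_bounded (singular_integral \<Omega>) P p)))
     \<and>
     (CARD('m::finite) \<ge> 3 \<longrightarrow>
       (\<forall>(P :: 'm \<Rightarrow> real) (p::real) (q::real).
          (\<forall>i. 1 < P i) \<and> 1 / p = (\<Sum>i\<in>UNIV. 1 / P i) \<and> 1 < q \<and>
          p < q / ((q - 1) * real CARD('m) + 2) \<longrightarrow>
          (\<exists>\<Omega> :: real ^ 'm \<Rightarrow> complex.
             odd_on_sphere \<Omega> \<and>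
             in_Lp q sphere_measure \<Omega> \<and>
             supported_in \<Omega> {\<theta> \<in> sphere 0 1.
                \<forall>i j. i \<noteq> j \<longrightarrow> \<bar>\<theta> $ i - \<theta> $ j\<bar> > real CARD('m) powr (- 3 / 2)} \<and>
             \<not> multilinear_bounded (singular_integral \<Omega>) P p)))"
proof (intro conjI impI allI)
  fix P :: "2 \<Rightarrow> real" and p q :: real
  assume n: "CARD('n) \<ge> 2" and A: "(\<forall>i. 1 < P i) \<and> 1 / p = 1 / P 1 + 1 / P 2 \<and> 1 < q \<and>
          p < real CARD('n) * q / (1 - real CARD('n) + 2 * real CARD('n) * q)"
  \<comment> \<open>Any coordinate vector serves.\<close>
  define e :: "real ^ 'n" where "e = axis undefined 1"
  have e: "norm e = 1" by (simp add: e_def)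
  define \<theta> :: "(real ^ 'n) ^ 2" where "\<theta> = (\<chi> i. (if i = 1 then 1 / sqrt 2 else - 1 / sqrt 2) *\<^sub>R e)"
  have \<theta>: "norm \<theta> = 1"
  proof -
    have "norm (\<theta> $ i) = 1 / sqrt 2" for i by (simp add: \<theta>_def e)
    then show ?thesis by (simp add: norm_vec_def[of \<theta>] L2_set_def UNIV_2 power_divide)
  qed
  have \<theta>12: "norm (\<theta> $ 1 - \<theta> $ 2) = sqrt 2"
  proof -
    have "\<theta> $ 1 - \<theta> $ 2 = (2 / sqrt 2) *\<^sub>R e"
      by (simp add: \<theta>_def flip: scaleR_add_left)
    then show ?thesis by (simp add: e real_div_sqrt)
  qed
  then have ne: "\<theta> $ 1 \<noteq> \<theta> $ 2" by auto
  define U where "U = {\<theta> :: (real ^ 'n) ^ 2. norm (\<theta> $ 1 - \<theta> $ 2) > 1 / 2}"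
  have U: "open U"
    unfolding U_def by (intro open_Collect_less continuous_intros)
  have "1 / 2 < sqrt 2" using real_sqrt_gt_1_iff[of 2] by linarith
  then have \<theta>U: "\<theta> \<in> U" by (simp add: U_def \<theta>12)
  have Usym: "- y \<in> U" if "y \<in> U" for y
    using that by (simp add: U_def norm_minus_commute)
  have "1 / p > 0" using A by (simp add: add_pos_pos order_less_trans[OF zero_less_one])
  then have p: "p > 0" by (simp add: zero_less_divide_iff)
  have "\<exists>\<Omega> :: (real ^ 'n) ^ 2 \<Rightarrow> complex. odd_on_sphere \<Omega> \<and> in_Lp q sphere_measure \<Omega> \<and>
    supported_in \<Omega> {y \<in> sphere 0 1. y \<in> U} \<and> \<not> multilinear_bounded (singular_integral \<Omega>) P p"
  proof (rule exists_unbounded_rough_singular_integral[OF \<theta> ne _ _ U \<theta>U Usym])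
    show "CARD(2) * DIM(real ^ 'n) = DIM(real ^ 'n) + 1 + (CARD('n) - 1)" "0 < CARD('n) - 1"
      using n by auto
    show "1 / p = (\<Sum>i\<in>UNIV. 1 / P i)" using A by (simp add: UNIV_2)
    have "2 * real CARD('n) - (real CARD('n) - 1) / q < real CARD('n) / p"
      using A p n by (intro gap_of_exponent_bound) (auto simp: algebra_simps)
    then show "real (CARD(2) * DIM(real ^ 'n)) - real (CARD('n) - 1) / q < real DIM(real ^ 'n) / p"
      using n by (simp add: of_nat_diff)
  qed (use A in auto)
  then show "\<exists>\<Omega> :: (real ^ 'n) ^ 2 \<Rightarrow> complex.
             odd_on_sphere \<Omega> \<and>
             in_Lp q sphere_measure \<Omega> \<and>
             supported_in \<Omega> {\<theta> \<in> sphere 0 1. norm (\<theta> $ 1 - \<theta> $ 2) > 1 / 2} \<and>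
             \<not> multilinear_bounded (singular_integral \<Omega>) P p"
    by (simp add: U_def)
next
  fix P :: "'m \<Rightarrow> real" and p q :: real
  assume m: "CARD('m) \<ge> 3" and A: "(\<forall>i. 1 < P i) \<and> 1 / p = (\<Sum>i\<in>UNIV. 1 / P i) \<and> 1 < q \<and>
          p < q / ((q - 1) * real CARD('m) + 2)"
  define M where "M = real CARD('m)"
  have M: "M \<ge> 3" using m by (simp add: M_def)
  \<comment> \<open>Numbering the coordinates by \<open>0, \<dots>, m - 1\<close> gives a vector of gaps at least \<open>1\<close> and squared norm below \<open>m\<^sup>3\<close>.\<close>
  obtain h :: "'m \<Rightarrow> nat" where h: "bij_betw h UNIV {0..<CARD('m)}"
    using ex_bij_betw_finite_nat[of "UNIV :: 'm set"] by auto
  define w :: "real ^ 'm" where "w = (\<chi> i. real (h i))"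
  have h_lt: "h i < CARD('m)" for i using h by (auto simp: bij_betw_def)
  have h_inj: "h i = h j \<longleftrightarrow> i = j" for i j using h by (auto simp: bij_betw_def inj_on_def)
  have w_diff: "\<bar>w $ i - w $ j\<bar> \<ge> 1" if "i \<noteq> j" for i j
    using h_inj[of i j] that by (simp add: w_def)
  have w_norm: "norm w < M powr (3 / 2)"
  proof -
    have "(norm w)\<^sup>2 = (\<Sum>i\<in>UNIV. (real (h i))\<^sup>2)"
      by (simp add: norm_vec_def L2_set_def w_def sum_nonneg)
    also have "\<dots> < (\<Sum>i\<in>(UNIV::'m set). M\<^sup>2)"
      using h_lt by (intro sum_strict_mono) (auto simp: M_def intro!: power_strict_mono)
    also have "\<dots> = M ^ 3" by (simp add: M_def power2_eq_square power3_eq_cube)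
    also have "\<dots> = (M powr (3 / 2))\<^sup>2"
    proof -
      have "(M powr (3 / 2))\<^sup>2 = M powr (3 / 2 + 3 / 2)"
        unfolding power2_eq_square powr_add ..
      then show ?thesis using M by (simp add: powr_numeral)
    qed
    finally show ?thesis by (rule power_less_imp_less_base) simp
  qed
  have "\<exists>i j::'m. i \<noteq> j"
  proof -
    have "\<not> CARD('m) \<le> Suc 0" using m by simp
    then show ?thesis by (auto simp: card_le_Suc0_iff_eq)
  qed
  then obtain i j :: 'm where ij: "i \<noteq> j" by blast
  have w0: "norm w > 0" using w_diff[OF ij] by auto
  define \<theta> where "\<theta> = w /\<^sub>R norm w"
  have \<theta>: "norm \<theta> = 1" using w0 by (simp add: \<theta>_def)
  have \<theta>_diff: "\<bar>\<theta> $ i - \<theta> $ j\<bar> > M powr (- 3 / 2)" if "i \<noteq> j" for i j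
  proof -
    have "M powr (- 3 / 2) = 1 / M powr (3 / 2)" using M by (simp add: powr_minus_divide)
    also have "\<dots> < 1 / norm w" using w_norm w0 by (intro divide_strict_left_mono mult_pos_pos) linarith+
    also have "\<dots> \<le> \<bar>w $ i - w $ j\<bar> / norm w" using w_diff[OF that] w0 by (intro divide_right_mono) auto
    also have "\<dots> = \<bar>\<theta> $ i - \<theta> $ j\<bar>"
      using w0 by (simp add: \<theta>_def abs_mult field_simps flip: right_diff_distrib)
    finally show ?thesis .
  qed
  then have ne: "\<theta> $ i \<noteq> \<theta> $ j" using ij by force
  define U where "U = {\<theta> :: real ^ 'm. \<forall>i j. i \<noteq> j \<longrightarrow> \<bar>\<theta> $ i - \<theta> $ j\<bar> > M powr (- 3 / 2)}"
  have U: "open U"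
  proof -
    have "U = (\<Inter>i. \<Inter>j\<in>-{i}. {\<theta> :: real ^ 'm. \<bar>\<theta> $ i - \<theta> $ j\<bar> > M powr (- 3 / 2)})"
      by (auto simp: U_def)
    also have "open \<dots>"
      by (intro open_INT ballI open_Collect_less continuous_intros) auto
    finally show ?thesis .
  qed
  have \<theta>U: "\<theta> \<in> U" using \<theta>_diff by (simp add: U_def)
  have Usym: "- y \<in> U" if "y \<in> U" for y
    using that by (simp add: U_def abs_minus_commute)
  have "1 / p > 0" using A by (auto intro!: sum_pos simp: order_less_trans[OF zero_less_one])
  then have p: "p > 0" by (simp add: zero_less_divide_iff)
  have "\<exists>\<Omega> :: real ^ 'm \<Rightarrow> complex. odd_on_sphere \<Omega> \<and> in_Lp q sphere_measure \<Omega> \<and>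
    supported_in \<Omega> {y \<in> sphere 0 1. y \<in> U} \<and> \<not> multilinear_bounded (singular_integral \<Omega>) P p"
  proof (rule exists_unbounded_rough_singular_integral[OF \<theta> ne _ _ U \<theta>U Usym])
    show "CARD('m) * DIM(real) = DIM(real) + 1 + (CARD('m) - 2)" "0 < CARD('m) - 2"
      using m by auto
    have "M - (M - 2) / q < 1 / p"
      using A p M by (intro gap_of_exponent_bound) (auto simp: algebra_simps M_def)
    then show "real (CARD('m) * DIM(real)) - real (CARD('m) - 2) / q < real DIM(real) / p"
      using m by (simp add: of_nat_diff M_def)
  qed (use A in auto)
  then show "\<exists>\<Omega> :: real ^ 'm \<Rightarrow> complex.
             odd_on_sphere \<Omega> \<and>
             in_Lp q sphere_measure \<Omega> \<and>
             supported_in \<Omega> {\<theta> \<in> sphere 0 1.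
                \<forall>i j. i \<noteq> j \<longrightarrow> \<bar>\<theta> $ i - \<theta> $ j\<bar> > real CARD('m) powr (- 3 / 2)} \<and>
             \<not> multilinear_bounded (singular_integral \<Omega>) P p"
    by (simp add: U_def M_def)
qed

end
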